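(* Let $a<c<b$ be real numbers and let $T:[a,b]\to[a,b]$ be a continuous map which is (strictly) increasing from $[a,c]$ onto $[a,b]$ and (strictly) decreasing from $[c,b]$ onto $[a,b]$. For every function of bounded variation $\varphi:[a,b]\to\mathbb{R}$ whose total variation satisfies $$\operatorname{BV}(\varphi)\le 0.0069,$$ the transfer operator $\mathrm{L}_{T,\varphi}$ has a spectral gap when acting on the Banach space $\operatorname{BV}([a,b])$ of real-valued functions of bounded variation on $[a,b]$.
   Context: Let $b_1:[a,b]\to[a,c]$ and $b_2:[a,b]\to[c,b]$ be the inverses of the restrictions of $T$ to $[a,c]$ and to $[c,b]$ respectively. The transfer operator of $T$ with potential $\varphi$ is the average over inverse images counted with multiplicity: $$\mathrm{L}_{T,\varphi}f(x)=\frac12\sum_{j=1}^2 e^{\varphi(b_j(x))}f(b_j(x)).$$ The total variation is $\operatorname{BV}(f)=\sup\sum_{j=1}^n|f(x_j)-f(x_{j-1})|$, the supremum being over all finite sequences $x_0<x_1<\dots<x_n$ in $[a,b]$; $\operatorname{BV}([a,b])$ is the space of functions $f$ with $\operatorname{BV}(f)<\infty$, endowed with the norm $\lVert f\rVert=\lVert f\rVert_\infty+\operatorname{BV}(f)$. A bounded linear operator $\mathrm{L}$ on a Banach space $\mathcal{X}$ has a spectral gap if it has an eigenvalue $\lambda>0$ with an eigenvector $u_0$, and there are a closed subspace $G\subset\mathcal{X}$ with $\langle u_0\rangle\oplus G=\mathcal{X}$ and $\mathrm{L}(G)\subset G$, and numbers $C>0$, $\delta\in(0,1)$, such that $\lVert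 (\mathrm{L}|_G)^n\rVert\le C\lambda^n(1-\delta)^n$ for all $n\in\mathbb{N}$. *)

theory Defs
  imports "HOL-Analysis.Analysis" "HOL-Library.Function_Algebras"
begin

instantiation "fun" :: (type, real_vector) real_vector
begin

definition scaleR_fun :: "real \<Rightarrow> ('a \<Rightarrow> 'b) \<Rightarrow> 'a \<Rightarrow> 'b"
  where "scaleR_fun r f = (\<lambda>x. r *\<^sub>R f x)"

instance
  by standard (simp_all add: scaleR_fun_def fun_eq_iff scaleR_add_right scaleR_add_left)

end

lemma scaleR_fun_apply [simp]: "(r *\<^sub>R f) x = r *\<^sub>R f x"
  by (simp add: scaleR_fun_def)


section \<open>Spectral gap of an operator on a Banach space\<close>

text \<open>
  The function space of interest depends on the interval, i.e. on term variables, so it cannot be a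
  type of class \<^class>\<open>banach\<close>. Normed spaces are therefore given by a linear subspace \<open>X\<close> of an
  ambient real vector space together with a function \<open>N\<close> that is a norm on \<open>X\<close> (its values
  off \<open>X\<close> are irrelevant).
\<close>

definition norm_on :: "'v::real_vector set \<Rightarrow> ('v \<Rightarrow> real) \<Rightarrow> bool"
  where "norm_on X N \<longleftrightarrow>
    (\<forall>x\<in>X. 0 \<le> N x \<and> (N x = 0 \<longleftrightarrow> x = 0)) \<and>
    (\<forall>x\<in>X. \<forall>y\<in>X. N (x + y) \<le> N x + N y) \<and>
    (\<forall>x\<in>X. \<forall>r. N (r *\<^sub>R x) = \<bar>r\<bar> * N x)"

text \<open>
  The locale \<^locale>\<open>Metric_space\<close> requires nonnegativity and symmetry of the distance on the whole
  ambient type, hence the value 0 off \<open>X\<close>.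
\<close>

definition norm_dist :: "'v::real_vector set \<Rightarrow> ('v \<Rightarrow> real) \<Rightarrow> 'v \<Rightarrow> 'v \<Rightarrow> real"
  where "norm_dist X N x y = (if x \<in> X \<and> y \<in> X then N (x - y) else 0)"

lemma Metric_space_norm_dist:
  assumes "subspace X" and "norm_on X N"
  shows "Metric_space X (norm_dist X N)"
proof
  note norm = assms(2)[unfolded norm_on_def]
  have diff: "x - y \<in> X" if "x \<in> X" "y \<in> X" for x y
    using assms(1) that by (rule subspace_diff)
  fix x y z
  show "0 \<le> norm_dist X N x y"
  proof (cases "x \<in> X \<and> y \<in> X")
    case True
    then have "0 \<le> N (x - y)"
      using bspec[OF conjunct1[OF norm] diff, of x y] by (rule_tac conjunct1) simp_all
    then show ?thesis by (simp only: norm_dist_def True simp_thms if_True)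
  qed (simp only: norm_dist_def if_False order_refl)
  show "norm_dist X N x y = norm_dist X N y x"
  proof (cases "x \<in> X \<and> y \<in> X")
    case True
    then have "N (- 1 *\<^sub>R (x - y)) = \<bar>- 1\<bar> * N (x - y)"
      using bspec[OF conjunct2[OF conjunct2[OF norm]] diff, of x y] by (rule_tac spec) simp_all
    moreover have "- 1 *\<^sub>R (x - y) = y - x" by simp
    ultimately have "N (y - x) = N (x - y)" by (simp only: abs_minus_cancel abs_one mult_1)
    then show ?thesis by (simp only: norm_dist_def conj_commute)
  qed (simp only: norm_dist_def if_False conj_commute)
next
  note norm = assms(2)[unfolded norm_on_def]
  fix x y assume "x \<in> X" "y \<in> X"
  then have xy: "x - y \<in> X"
    using subspace_diff[OF assms(1)] by blast
  have "N (x - y) = 0 \<longleftrightarrow> x - y = 0"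
    using bspec[OF conjunct1[OF norm] xy] by (rule conjunct2)
  then show "norm_dist X N x y = 0 \<longleftrightarrow> x = y"
    by (simp only: norm_dist_def \<open>x \<in> X\<close> \<open>y \<in> X\<close> simp_thms if_True right_minus_eq)
next
  note norm = assms(2)[unfolded norm_on_def]
  fix x y z assume "x \<in> X" "y \<in> X" "z \<in> X"
  then have xy: "x - y \<in> X" and yz: "y - z \<in> X"
    using subspace_diff[OF assms(1)] by blast+
  have "N ((x - y) + (y - z)) \<le> N (x - y) + N (y - z)"
    using bspec[OF bspec[OF conjunct1[OF conjunct2[OF norm]] xy] yz] .
  moreover have "(x - y) + (y - z) = x - z" by simp
  ultimately have "N (x - z) \<le> N (x - y) + N (y - z)" by (simp only:)
  then show "norm_dist X N x z \<le> norm_dist X N x y + norm_dist X N y z"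
    by (simp only: norm_dist_def \<open>x \<in> X\<close> \<open>y \<in> X\<close> \<open>z \<in> X\<close> simp_thms if_True)
qed

definition banach_on :: "'v::real_vector set \<Rightarrow> ('v \<Rightarrow> real) \<Rightarrow> bool"
  where "banach_on X N \<longleftrightarrow>
    subspace X \<and> norm_on X N \<and> Metric_space.mcomplete X (norm_dist X N)"

definition bounded_linear_operator_on ::
    "'v::real_vector set \<Rightarrow> ('v \<Rightarrow> real) \<Rightarrow> ('v \<Rightarrow> 'v) \<Rightarrow> bool"
  where "bounded_linear_operator_on X N L \<longleftrightarrow>
    L ` X \<subseteq> X \<and>
    (\<forall>x\<in>X. \<forall>y\<in>X. L (x + y) = L x + L y) \<and>
    (\<forall>x\<in>X. \<forall>r. L (r *\<^sub>R x) = r *\<^sub>R L x) \<and>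
    (\<exists>K. \<forall>x\<in>X. N (L x) \<le> K * N x)"

text \<open>
  Relativised version of \<^const>\<open>onorm\<close>; it is the operator norm whenever \<open>A\<close> is bounded on \<open>G\<close>.
\<close>

definition onorm_on :: "'v set \<Rightarrow> ('v \<Rightarrow> real) \<Rightarrow> ('v \<Rightarrow> 'v) \<Rightarrow> real"
  where "onorm_on G N A = (SUP g\<in>G. N (A g) / N g)"

text \<open>
  Since \<open>L\<close> maps \<open>G\<close> to itself, \<open>L ^^ n\<close> agrees on \<open>G\<close> with the \<open>n\<close>-th iterate of the restriction
  of \<open>L\<close> to \<open>G\<close>. The topology on \<open>X\<close> is that of \<open>N\<close>, not the one of the ambient type (if any).
\<close>

definition has_spectral_gap ::
    "'v::real_vector set \<Rightarrow> ('v \<Rightarrow> real) \<Rightarrow> ('v \<Rightarrow> 'v) \<Rightarrow> bool"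
  where "has_spectral_gap X N L \<longleftrightarrow>
    banach_on X N \<and> bounded_linear_operator_on X N L \<and>
    (\<exists>ev>0. \<exists>u0\<in>X. u0 \<noteq> 0 \<and> L u0 = ev *\<^sub>R u0 \<and>
      (\<exists>G. G \<subseteq> X \<and> subspace G \<and>
        closedin (Metric_space.mtopology X (norm_dist X N)) G \<and>
        {v + g | v g. v \<in> span {u0} \<and> g \<in> G} = X \<and> span {u0} \<inter> G = {0} \<and>
        L ` G \<subseteq> G \<and>
        (\<exists>C>0. \<exists>\<delta>. 0 < \<delta> \<and> \<delta> < 1 \<and>
          (\<forall>n. onorm_on G N (L ^^ n) \<le> C * ev ^ n * (1 - \<delta>) ^ n))))"


section \<open>Functions of bounded variation\<close>

definition variation_sums :: "real \<Rightarrow> real \<Rightarrow> (real \<Rightarrow> real) \<Rightarrow> real set"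
  where "variation_sums a b f =
    {\<Sum>j=1..n. \<bar>f (x j) - f (x (j - 1))\<bar> | (n::nat) (x::nat \<Rightarrow> real).
       strict_mono_on {0..n} x \<and> x ` {0..n} \<subseteq> {a..b}}"

definition bounded_variation :: "real \<Rightarrow> real \<Rightarrow> (real \<Rightarrow> real) \<Rightarrow> bool"
  where "bounded_variation a b f \<longleftrightarrow> bdd_above (variation_sums a b f)"

text \<open>Meaningful only for functions of bounded variation.\<close>

definition total_variation :: "real \<Rightarrow> real \<Rightarrow> (real \<Rightarrow> real) \<Rightarrow> real"
  where "total_variation a b f = Sup (variation_sums a b f)"

text \<open>Functions on \<open>[a,b]\<close> are represented by their extension by zero.\<close>

definition BV_space :: "real \<Rightarrow> real \<Rightarrow> (real \<Rightarrow> real) set"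
  where "BV_space a b = {f. (\<forall>x. x \<notin> {a..b} \<longrightarrow> f x = 0) \<and> bounded_variation a b f}"

definition BV_norm :: "real \<Rightarrow> real \<Rightarrow> (real \<Rightarrow> real) \<Rightarrow> real"
  where "BV_norm a b f = (SUP x\<in>{a..b}. \<bar>f x\<bar>) + total_variation a b f"


section \<open>The transfer operator\<close>

text \<open>
  The turning point \<open>c\<close> is the middle argument. At \<open>x = b\<close> both inverse branches take the value
  \<open>c\<close>, which is thus counted twice.
\<close>

definition transfer_operator ::
    "real \<Rightarrow> real \<Rightarrow> real \<Rightarrow> (real \<Rightarrow> real) \<Rightarrow> (real \<Rightarrow> real) \<Rightarrow> (real \<Rightarrow> real) \<Rightarrow> real \<Rightarrow> real"
  where "transfer_operator a c b T \<phi> f x =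
    (let b1 = the_inv_into {a..c} T; b2 = the_inv_into {c..b} T
     in if x \<in> {a..b}
        then 1/2 * (exp (\<phi> (b1 x)) * f (b1 x) + exp (\<phi> (b2 x)) * f (b2 x))
        else 0)"

end

theory Submission
  imports Defs
begin

text \<open>
  Without potential the operator halves the total variation: the two inverse branches are monotone
  with essentially disjoint ranges, so the variations of \<open>f \<circ> b1\<close> and \<open>f \<circ> b2\<close> add up to at
  most that of \<open>f\<close>. With a potential of small variation, \<open>L\<close> still contracts the variation on
  functions vanishing at \<open>a\<close> by about one half of the size of \<open>L 1\<close>, and almost preserves the
  constants. So \<open>f \<mapsto> L f / L f a\<close> is a contraction near the constant 1, with respect to the
  variation, and its fixed point \<open>u\<close> is an eigenvector. Modulo \<open>u\<close>, \<open>L\<close> contracts faster than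
  its eigenvalue \<open>ev\<close>, so \<open>(L ^^ n) f a / ev ^ n\<close> converges to a bounded functional whose kernel
  is the invariant complement.
\<close>

section \<open>A criterion for a spectral gap\<close>

text \<open>A geometric bound on the steps gives convergence and a rate at once. It serves twice:
  for the fixed-point iteration in the function space and for real sequences of
  coefficients.\<close>

lemma (in Metric_space) geometric_limit:
  assumes "mcomplete" and s: "range s \<subseteq> M"
    and step: "\<And>n. d (s n) (s (Suc n)) \<le> C * q ^ n" and q: "0 \<le> q" "q < 1"
  obtains x where "x \<in> M" "\<And>n. d (s n) x \<le> C / (1 - q) * q ^ n"
proof -
  have sM: "s n \<in> M" for n
    using s by auto
  have C: "0 \<le> C"
    using order_trans[OF nonneg step[of 0]] by simp
  define K where "K = C / (1 - q)"
  have K: "C = K * (1 - q)" "0 \<le> K"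
    using C q by (auto simp: K_def)
  \<comment> \<open>The subtracted power makes the induction close: as
    \<open>C = K * (1 - q)\<close>, the next step is exactly the growth of the right-hand
    side.\<close>
  have tail: "d (s n) (s (n + k)) \<le> K * (q ^ n - q ^ (n + k))" for n k
  proof (induction k)
    case 0
    then show ?case using mdist_zero[OF sM[of n]] by simp
  next
    case (Suc k)
    have "d (s n) (s (n + Suc k)) \<le> d (s n) (s (n + k)) + d (s (n + k)) (s (Suc (n + k)))"
      using triangle[OF sM[of n] sM[of "n + k"] sM[of "Suc (n + k)"]] by simp
    also have "\<dots> \<le> K * (q ^ n - q ^ (n + k)) + C * q ^ (n + k)"
      by (intro add_mono Suc step)
    also have "\<dots> = K * (q ^ n - q ^ (n + Suc k))"
      by (simp add: K(1) algebra_simps)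
    finally show ?case .
  qed
  have bound: "d (s n) (s m) \<le> K * q ^ n" if nm: "n \<le> m" for n m
  proof -
    obtain k where "m = n + k" using le_Suc_ex[OF nm] by auto
    then have "d (s n) (s m) \<le> K * (q ^ n - q ^ (n + k))"
      using tail by simp
    also have "\<dots> \<le> K * q ^ n"
      using K q by (intro mult_left_mono) auto
    finally show ?thesis .
  qed
  have null: "(\<lambda>n. K * q ^ n) \<longlonglongrightarrow> 0"
    using q by (intro tendsto_mult_right_zero LIMSEQ_power_zero) simp
  have "MCauchy s"
    unfolding MCauchy_def
  proof (intro conjI s allI impI)
    fix \<epsilon> :: real assume "0 < \<epsilon>"
    then obtain N where N: "\<And>n. N \<le> n \<Longrightarrow> K * q ^ n < \<epsilon>"
      using order_tendstoD(2)[OF null] by (auto simp: eventually_sequentially)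
    have "d (s n) (s n') < \<epsilon>" if "N \<le> n" "N \<le> n'" for n n'
    proof (cases "n \<le> n'")
      case True
      then show ?thesis using le_less_trans[OF bound[OF True] N[OF that(1)]] by simp
    next
      case False
      then have "d (s n') (s n) < \<epsilon>" using le_less_trans[OF bound N[OF that(2)], of n] by simp
      then show ?thesis by (simp add: commute)
    qed
    then show "\<exists>N. \<forall>n n'. N \<le> n \<longrightarrow> N \<le> n' \<longrightarrow> d (s n) (s n') < \<epsilon>" by blast
  qed
  then obtain x where x: "limitin mtopology s x sequentially"
    using assms(1) unfolding mcomplete_def by blast
  have xM: "x \<in> M"
    using x limitin_mspace by blast
  have lim: "(\<lambda>m. d (s m) x) \<longlonglongrightarrow> 0"
    using x by (simp add: limitin_metric_dist_null)
  have "d (s n) x \<le> K * q ^ n" for n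
  proof (rule LIMSEQ_le_const)
    show "(\<lambda>m. K * q ^ n + d (s m) x) \<longlonglongrightarrow> K * q ^ n"
      using tendsto_add[OF tendsto_const lim, of "K * q ^ n"] by simp
    have "d (s n) x \<le> K * q ^ n + d (s m) x" if "n \<le> m" for m
      using triangle[OF sM[of n] sM[of m] xM] bound[OF that] by linarith
    then show "\<exists>N. \<forall>m\<ge>N. d (s n) x \<le> K * q ^ n + d (s m) x" by blast
  qed
  then show ?thesis using that xM K_def by blast
qed

text \<open>In the application \<open>p\<close> is evaluation at \<open>a\<close>, \<open>V\<close>
  the total variation and \<open>e\<close> the constant 1. \<open>N_le\<close> makes
  \<open>V\<close> control the norm on the kernel of \<open>p\<close>. There \<kappa> and \<beta>
  bound \<open>L h\<close> in \<open>V\<close> and in \<open>p\<close>, while \<gamma> and \<alpha>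
  describe \<open>L e\<close>. The condition \<open>invariant\<close> preserves the set
  \<open>V f \<le> r\<close> within \<open>p f = 1\<close> under the normalised operator, and
  \<open>gap\<close> makes that operator a contraction.\<close>

locale dominated_operator =
  fixes X :: "'v::real_vector set" and N :: "'v \<Rightarrow> real" and L :: "'v \<Rightarrow> 'v"
    and p V :: "'v \<Rightarrow> real" and e :: 'v and \<kappa> \<beta> \<gamma> \<alpha> r :: real
  assumes banach: "banach_on X N"
    and bounded: "bounded_linear_operator_on X N L"
    and p_add: "\<And>f g. f \<in> X \<Longrightarrow> g \<in> X \<Longrightarrow> p (f + g) = p f + p g"
    and p_scale: "\<And>f t. f \<in> X \<Longrightarrow> p (t *\<^sub>R f) = t * p f"
    and V_add: "\<And>f g. f \<in> X \<Longrightarrow> g \<in> X \<Longrightarrow> V (f + g) \<le> V f + V g"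
    and V_scale: "\<And>f t. f \<in> X \<Longrightarrow> V (t *\<^sub>R f) = \<bar>t\<bar> * V f"
    and p_le: "\<And>f. f \<in> X \<Longrightarrow> \<bar>p f\<bar> \<le> N f"
    and V_le: "\<And>f. f \<in> X \<Longrightarrow> V f \<le> N f"
    and N_le: "\<And>f. f \<in> X \<Longrightarrow> N f \<le> \<bar>p f\<bar> + 2 * V f"
    and e: "e \<in> X" "p e = 1" "V e = 0"
    and V_L: "\<And>h. h \<in> X \<Longrightarrow> p h = 0 \<Longrightarrow> V (L h) \<le> \<kappa> * V h"
    and p_L: "\<And>h. h \<in> X \<Longrightarrow> p h = 0 \<Longrightarrow> \<bar>p (L h)\<bar> \<le> \<beta> * V h"
    and V_L_e: "V (L e) \<le> \<gamma>"
    and p_L_e: "\<alpha> \<le> p (L e)"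
    and pos: "0 < \<kappa>" "0 \<le> \<beta>" "0 \<le> r"
    and invariant: "\<gamma> + \<kappa> * r \<le> r * (\<alpha> - \<beta> * r)"
    and gap: "\<kappa> + \<beta> * r < \<alpha> - \<beta> * r"
begin

text \<open>Numerator: the rate at which \<open>L\<close>, followed by a projection onto the kernel
  of \<open>p\<close>, contracts \<open>V\<close>. Denominator: a lower bound for
  \<open>p (L f)\<close> on \<open>B\<close>. So \<open>q\<close> bounds the contraction ratio of
  the normalised operator.\<close>

definition q :: real
  where "q = (\<kappa> + \<beta> * r) / (\<alpha> - \<beta> * r)"

text \<open>The slice at height 1 of the cone \<open>V f \<le> r * p f\<close>.\<close>

definition B :: "'v set"
  where "B = {f \<in> X. p f = 1 \<and> V f \<le> r}"

lemma denominator_pos: "0 < \<alpha> - \<beta> * r"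
proof -
  have "0 < \<kappa> + \<beta> * r"
    using pos by (simp add: add_pos_nonneg)
  then show ?thesis
    using gap by linarith
qed

lemma q_bounds: "0 < q" "q < 1"
  using denominator_pos gap pos by (auto simp: q_def divide_simps intro: add_pos_nonneg)

lemma sub: "subspace X" and norm: "norm_on X N"
  and complete: "Metric_space.mcomplete X (norm_dist X N)"
  using banach by (auto simp: banach_on_def)

lemma X_closed [simp]:
  "f \<in> X \<Longrightarrow> g \<in> X \<Longrightarrow> f + g \<in> X" "f \<in> X \<Longrightarrow> g \<in> X \<Longrightarrow> f - g \<in> X"
  "f \<in> X \<Longrightarrow> t *\<^sub>R f \<in> X" "0 \<in> X" "f \<in> X \<Longrightarrow> L f \<in> X"
  using sub bounded
  by (auto simp: bounded_linear_operator_on_def intro: subspace_add subspace_diff subspace_scale subspace_0)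

lemma e_in_X [simp]: "e \<in> X"
  by (rule e)

lemma N_nonneg: "f \<in> X \<Longrightarrow> 0 \<le> N f" and N_zero_iff: "f \<in> X \<Longrightarrow> N f = 0 \<longleftrightarrow> f = 0"
  and N_scale: "f \<in> X \<Longrightarrow> N (t *\<^sub>R f) = \<bar>t\<bar> * N f"
  using norm by (auto simp: norm_on_def)

lemma L_add: "f \<in> X \<Longrightarrow> g \<in> X \<Longrightarrow> L (f + g) = L f + L g"
  and L_scale: "f \<in> X \<Longrightarrow> L (t *\<^sub>R f) = t *\<^sub>R L f"
  using bounded by (auto simp: bounded_linear_operator_on_def)

lemma L_diff: "f \<in> X \<Longrightarrow> g \<in> X \<Longrightarrow> L (f - g) = L f - L g"
  using L_add[of f "- 1 *\<^sub>R g"] L_scale[of g "- 1"] X_closed(3)[of g "- 1"] by simp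

lemma p_diff: "f \<in> X \<Longrightarrow> g \<in> X \<Longrightarrow> p (f - g) = p f - p g"
  using p_add[of f "- 1 *\<^sub>R g"] p_scale[of g "- 1"] X_closed(3)[of g "- 1"] by simp

lemma V_diff: "f \<in> X \<Longrightarrow> g \<in> X \<Longrightarrow> V (f - g) \<le> V f + V g"
  using V_add[of f "- 1 *\<^sub>R g"] V_scale[of g "- 1"] X_closed(3)[of g "- 1"] by simp

lemma N_commute: "f \<in> X \<Longrightarrow> g \<in> X \<Longrightarrow> N (f - g) = N (g - f)"
  using N_scale[of "g - f" "- 1"] by simp

lemma V_nonneg: "f \<in> X \<Longrightarrow> 0 \<le> V f"
  using V_diff[of f f] V_scale[of f 0] by simp

section \<open>The slice \<open>B\<close> and the normalised operator\<close>

lemma B_D: "f \<in> B \<Longrightarrow> f \<in> X" "f \<in> B \<Longrightarrow> p f = 1" "f \<in> B \<Longrightarrow> V f \<le> r"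
  by (auto simp: B_def)

text \<open>Split \<open>f = e + (f - e)\<close>: the second summand lies in the kernel of
  \<open>p\<close>, and its \<open>V\<close> is at most \<open>r\<close> because
  \<open>V e = 0\<close>.\<close>

lemma p_L_B:
  assumes "f \<in> B"
  shows "\<alpha> - \<beta> * r \<le> p (L f)"
proof -
  have f: "f \<in> X" "p f = 1" "V f \<le> r"
    using assms by (auto simp: B_def)
  have "\<bar>p (L (f - e))\<bar> \<le> \<beta> * V (f - e)"
    using f e by (intro p_L) (auto simp: p_diff)
  also have "\<dots> \<le> \<beta> * r"
    using f V_diff[OF f(1) e(1)] e pos by (intro mult_left_mono) auto
  finally show ?thesis
    using p_L_e f e by (simp add: L_diff p_diff)
qed

lemma V_L_B:
  assumes "f \<in> B"
  shows "V (L f) \<le> \<gamma> + \<kappa> * r"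
proof -
  have f: "f \<in> X" "p f = 1" "V f \<le> r"
    using assms by (auto simp: B_def)
  have "L f = L e + L (f - e)"
    using f e by (simp add: L_diff)
  then have "V (L f) \<le> V (L e) + V (L (f - e))"
    using V_add f e by (metis X_closed(2,5))
  moreover have "V (L (f - e)) \<le> \<kappa> * V (f - e)"
    using f e by (intro V_L) (auto simp: p_diff)
  moreover have "\<kappa> * V (f - e) \<le> \<kappa> * r"
    using f V_diff[OF f(1) e(1)] e pos by (intro mult_left_mono) auto
  ultimately show ?thesis
    using V_L_e by linarith
qed

text \<open>A fixed point of \<open>F\<close> in \<open>B\<close> is an eigenvector of
  \<open>L\<close> with eigenvalue \<open>p (L f)\<close>.\<close>

definition F :: "'v \<Rightarrow> 'v"
  where "F f = (1 / p (L f)) *\<^sub>R L f"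

lemma L_eq_F:
  assumes "f \<in> B"
  shows "L f = p (L f) *\<^sub>R F f"
  using p_L_B[OF assms] denominator_pos by (simp add: F_def)

text \<open>The hypothesis \<open>invariant\<close> compares the upper bound for
  \<open>V (L f)\<close> with \<open>r\<close> times the lower bound for
  \<open>p (L f)\<close>.\<close>

lemma F_B:
  assumes "f \<in> B"
  shows "F f \<in> B"
proof -
  have f: "f \<in> X"
    using assms by (auto simp: B_def)
  have pL: "0 < p (L f)" "\<alpha> - \<beta> * r \<le> p (L f)"
    using p_L_B[OF assms] denominator_pos by auto
  have "V (L f) \<le> r * (\<alpha> - \<beta> * r)"
    using V_L_B[OF assms] invariant by linarith
  also have "\<dots> \<le> r * p (L f)"
    using pL pos by (intro mult_left_mono)
  finally have "V (F f) \<le> r"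
    using f pL by (simp add: F_def V_scale divide_simps mult.commute)
  moreover have "p (F f) = 1"
    using f pL by (simp add: F_def p_scale)
  moreover have "F f \<in> X"
    using f by (simp add: F_def)
  ultimately show ?thesis
    by (simp add: B_def)
qed

text \<open>Since \<open>p g = 1\<close>, subtracting \<open>p (L h) *\<^sub>R g\<close> projects
  \<open>L h\<close> onto the kernel of \<open>p\<close> along \<open>g\<close>. The same estimate
  yields the contraction of \<open>F\<close> and the decay of iterates modulo the
  eigenvector.\<close>

lemma V_projection:
  assumes h: "h \<in> X" "p h = 0" and g: "g \<in> B"
  shows "V (L h - p (L h) *\<^sub>R g) \<le> (\<kappa> + \<beta> * r) * V h"
proof -
  have "V (L h - p (L h) *\<^sub>R g) \<le> V (L h) + \<bar>p (L h)\<bar> * V g"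
    using V_diff[of "L h" "p (L h) *\<^sub>R g"] h B_D[OF g] by (simp add: V_scale)
  also have "\<dots> \<le> \<kappa> * V h + (\<beta> * V h) * r"
    using V_L[OF h] p_L[OF h] V_nonneg h B_D[OF g] pos by (intro add_mono mult_mono) auto
  finally show ?thesis
    by (simp add: algebra_simps)
qed

text \<open>The normalisation is nonlinear, but \<open>p (L f) *\<^sub>R (F f - F g)\<close> is the
  projection of \<open>L (f - g)\<close> along \<open>F g\<close>, so the linear estimate applies;
  dividing by the lower bound for \<open>p (L f)\<close> gives \<open>q\<close>.\<close>

lemma F_contraction:
  assumes f: "f \<in> B" and g: "g \<in> B"
  shows "V (F f - F g) \<le> q * V (f - g)"
proof -
  define h where "h = f - g"
  have h: "h \<in> X" "p h = 0"
    using B_D[OF f] B_D[OF g] by (auto simp: h_def p_diff)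
  have pos_f: "0 < p (L f)" "\<alpha> - \<beta> * r \<le> p (L f)"
    using p_L_B[OF f] denominator_pos by auto
  have Fg: "F g \<in> B" "F g \<in> X"
    using F_B[OF g] B_D by auto
  have "L h - p (L h) *\<^sub>R F g = (L f - L g) - (p (L f) *\<^sub>R F g - p (L g) *\<^sub>R F g)"
    using B_D[OF f] B_D[OF g] by (simp add: h_def L_diff p_diff scaleR_diff_left)
  also have "\<dots> = p (L f) *\<^sub>R (F f - F g)"
    using L_eq_F[OF f] L_eq_F[OF g] by (simp add: scaleR_diff_right)
  finally have "V (p (L f) *\<^sub>R (F f - F g)) \<le> (\<kappa> + \<beta> * r) * V h"
    using V_projection[OF h Fg(1)] by simp
  then have "p (L f) * V (F f - F g) \<le> (\<kappa> + \<beta> * r) * V h"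
    using V_scale[of "F f - F g"] B_D(1)[OF F_B[OF f]] Fg pos_f by simp
  moreover have "(\<alpha> - \<beta> * r) * V (F f - F g) \<le> p (L f) * V (F f - F g)"
    using pos_f B_D(1)[OF F_B[OF f]] Fg by (intro mult_right_mono V_nonneg) auto
  ultimately have "(\<alpha> - \<beta> * r) * V (F f - F g) \<le> (\<kappa> + \<beta> * r) * V h"
    by linarith
  then show ?thesis
    using denominator_pos by (simp add: q_def h_def pos_le_divide_eq mult.commute)
qed

sublocale Metric_space X "norm_dist X N"
  by (rule Metric_space_norm_dist[OF sub norm])

lemma fixed_point: obtains u where "u \<in> B" "F u = u"
proof -
  define s where "s n = (F ^^ n) e" for n
  have s_Suc: "s (Suc n) = F (s n)" for n
    by (simp add: s_def)
  have sB: "s n \<in> B" for n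
    by (induction n) (use e pos F_B in \<open>auto simp: s_def B_def\<close>)
  have sX: "s n \<in> X" for n
    using sB B_D by blast
  have V_step: "V (s n - s (Suc n)) \<le> V (s 0 - s 1) * q ^ n" for n
  proof (induction n)
    case (Suc n)
    have "V (s (Suc n) - s (Suc (Suc n))) \<le> q * V (s n - s (Suc n))"
      using F_contraction[OF sB sB, of n "Suc n"] by (simp only: s_Suc)
    also have "\<dots> \<le> q * (V (s 0 - s 1) * q ^ n)"
      using Suc q_bounds by (intro mult_left_mono) auto
    finally show ?case by (simp add: algebra_simps)
  qed simp
  \<comment> \<open>Differences of elements of \<open>B\<close> lie in the kernel of
    \<open>p\<close>, so contraction in the seminorm \<open>V\<close> is enough for convergence in
    the norm.\<close>
  have N_V: "N (f - g) \<le> 2 * V (f - g)" if "f \<in> B" "g \<in> B" for f g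
    using N_le[of "f - g"] B_D[OF that(1)] B_D[OF that(2)] by (simp add: p_diff)
  have "norm_dist X N (s n) (s (Suc n)) \<le> (2 * V (s 0 - s 1)) * q ^ n" for n
    using N_V[OF sB sB, of n "Suc n"] V_step[of n] sX by (simp add: norm_dist_def)
  moreover have "range s \<subseteq> X"
    using sX by auto
  ultimately obtain u
    where u: "u \<in> X" "\<And>n. norm_dist X N (s n) u \<le> 2 * V (s 0 - s 1) / (1 - q) * q ^ n"
    using geometric_limit[OF complete, of s "2 * V (s 0 - s 1)" q] less_imp_le[OF q_bounds(1)] q_bounds(2)
    by blast
  have lim: "(\<lambda>n. 2 * V (s 0 - s 1) / (1 - q) * q ^ n) \<longlonglongrightarrow> 0"
    using q_bounds by (intro tendsto_mult_right_zero LIMSEQ_power_zero) simp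
  have N_null: "(\<lambda>n. N (u - s n)) \<longlonglongrightarrow> 0"
    using u sX N_nonneg by (intro Lim_null_comparison[OF _ lim])
      (auto simp: norm_dist_def N_commute)
  \<comment> \<open>Both \<open>V\<close> and \<open>p\<close> are dominated by the norm, hence the
    limit stays in \<open>B\<close>.\<close>
  have V_null: "(\<lambda>n. V (u - s n)) \<longlonglongrightarrow> 0"
    using u sX V_nonneg V_le by (intro Lim_null_comparison[OF _ N_null]) auto
  have p_null: "(\<lambda>n. p (u - s n)) \<longlonglongrightarrow> 0"
    using u sX p_le by (intro Lim_null_comparison[OF _ N_null]) auto
  have "p u = 1"
    using p_null u(1) sX B_D(2)[OF sB] by (simp add: p_diff LIMSEQ_const_iff)
  moreover have "V u \<le> r"
  proof (rule LIMSEQ_le_const)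
    show "(\<lambda>n. r + V (u - s n)) \<longlonglongrightarrow> r"
      using tendsto_add[OF tendsto_const V_null, of r] by simp
    have "V u \<le> r + V (u - s n)" for n
      using V_add[OF sX X_closed(2)[OF u(1) sX], of n n] B_D(3)[OF sB, of n] by simp
    then show "\<exists>N. \<forall>n\<ge>N. V u \<le> r + V (u - s n)" by blast
  qed
  ultimately have uB: "u \<in> B"
    using u by (simp add: B_def)
  have FX: "F u \<in> X"
    using F_B[OF uB] B_D by blast
  \<comment> \<open>Compare \<open>F u\<close> and \<open>u\<close> through
    \<open>F (s n) = s (Suc n)\<close>: both errors tend to 0.\<close>
  have "V (F u - u) \<le> 0"
  proof (rule LIMSEQ_le_const)
    show "(\<lambda>n. q * V (u - s n) + V (u - s (Suc n))) \<longlonglongrightarrow> 0"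
      using tendsto_add[OF tendsto_mult_left[OF V_null] LIMSEQ_Suc[OF V_null], of q] by simp
    have "V (F u - u) \<le> q * V (u - s n) + V (u - s (Suc n))" for n
    proof -
      have "V ((F u - F (s n)) - (u - s (Suc n))) \<le> V (F u - F (s n)) + V (u - s (Suc n))"
        using FX sX u(1) s_Suc[of n] B_D(1)[OF F_B[OF sB]] by (intro V_diff X_closed(2)) auto
      then show ?thesis
        using F_contraction[OF uB sB, of n] s_Suc[of n] by simp
    qed
    then show "\<exists>N. \<forall>n\<ge>N. V (F u - u) \<le> q * V (u - s n) + V (u - s (Suc n))" by blast
  qed
  then have "N (F u - u) \<le> 0"
    using N_V[OF F_B[OF uB] uB] by linarith
  then have "F u = u"
    using N_nonneg[of "F u - u"] N_zero_iff[of "F u - u"] FX u(1) by simp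
  then show ?thesis
    using that uB by blast
qed

section \<open>Iterates modulo the eigenvector\<close>

lemma iterate_X: "f \<in> X \<Longrightarrow> (L ^^ n) f \<in> X"
  by (induction n) auto

lemma iterate_add: "f \<in> X \<Longrightarrow> g \<in> X \<Longrightarrow> (L ^^ n) (f + g) = (L ^^ n) f + (L ^^ n) g"
  and iterate_scale: "f \<in> X \<Longrightarrow> (L ^^ n) (s *\<^sub>R f) = s *\<^sub>R (L ^^ n) f"
  by (induction n) (auto simp: L_add L_scale iterate_X)

text \<open>The eigenvalue is \<open>p (L u)\<close>, which is at least the denominator of
  \<open>q\<close>. Multiplying by \<open>q\<close> gives the third property: the projected operator
  contracts \<open>V\<close> at rate \<open>ev * q\<close>, below \<open>ev\<close>.\<close>

lemma eigenvector:
  obtains u ev where "u \<in> B" "0 < ev" "\<kappa> + \<beta> * r \<le> ev * q" "L u = ev *\<^sub>R u"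
proof -
  obtain u where u: "u \<in> B" "F u = u"
    by (rule fixed_point)
  have "\<alpha> - \<beta> * r \<le> p (L u)"
    by (rule p_L_B[OF u(1)])
  moreover from this have "\<kappa> + \<beta> * r \<le> p (L u) * q"
    using denominator_pos q_bounds mult_right_mono[of "\<alpha> - \<beta> * r" "p (L u)" q]
    by (simp add: q_def)
  ultimately show ?thesis
    using that[of u "p (L u)"] u L_eq_F[OF u(1)] denominator_pos by simp
qed

text \<open>
  Modulo the eigenvector the iterates decay like \<open>(ev * q) ^ n\<close>; hence the normalised coefficients
  \<open>p ((L ^^ n) f) / ev ^ n\<close> form a geometrically convergent sequence, whose limit is the
  eigenfunctional of the dual operator.
\<close>

lemma dual_eigenfunctional:
  assumes u: "u \<in> B" and ev: "0 < ev" "\<kappa> + \<beta> * r \<le> ev * q" and Lu: "L u = ev *\<^sub>R u"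
  obtains K l where "0 \<le> K"
    "\<And>f n. f \<in> X \<Longrightarrow> V ((L ^^ n) f - p ((L ^^ n) f) *\<^sub>R u) \<le> (ev * q) ^ n * V (f - p f *\<^sub>R u)"
    "\<And>f n. f \<in> X \<Longrightarrow> \<bar>p ((L ^^ n) f) / ev ^ n - l f\<bar> \<le> K * V (f - p f *\<^sub>R u) * q ^ n"
proof -
  \<comment> \<open>\<open>h f n\<close> is the component of the iterate in the kernel of
    \<open>p\<close> along \<open>u\<close>, and \<open>t f n\<close> its normalised
    coefficient.\<close>
  define h where "h f n = (L ^^ n) f - p ((L ^^ n) f) *\<^sub>R u" for f n
  define t where "t f n = p ((L ^^ n) f) / ev ^ n" for f n
  have uX: "u \<in> X" "p u = 1"
    using u B_D by auto
  have h: "h f n \<in> X" "p (h f n) = 0" if "f \<in> X" for f n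
    using iterate_X[OF that] uX by (auto simp: h_def p_diff p_scale)
  have Lh: "L (h f n) = L ((L ^^ n) f) - (p ((L ^^ n) f) * ev) *\<^sub>R u" if "f \<in> X" for f n
    using iterate_X[OF that] uX by (simp add: h_def L_diff L_scale Lu)
  have pLh: "p (L (h f n)) = p (L ((L ^^ n) f)) - p ((L ^^ n) f) * ev" if "f \<in> X" for f n
    using iterate_X[OF that] uX by (simp add: Lh[OF that] p_diff p_scale)
  \<comment> \<open>As \<open>L u\<close> is a multiple of \<open>u\<close>, the component along
    \<open>u\<close> drops out, and the components \<open>h\<close> obey a recursion of their
    own.\<close>
  have h_Suc: "h f (Suc n) = L (h f n) - p (L (h f n)) *\<^sub>R u" if "f \<in> X" for f n
    by (subst pLh[OF that], subst Lh[OF that]) (simp add: h_def scaleR_diff_left)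
  have V_h: "V (h f n) \<le> (ev * q) ^ n * V (h f 0)" if f: "f \<in> X" for f n
  proof (induction n)
    case (Suc n)
    have "V (h f (Suc n)) \<le> (\<kappa> + \<beta> * r) * V (h f n)"
      unfolding h_Suc[OF f] by (rule V_projection[OF h[OF f] u])
    also have "\<dots> \<le> (ev * q) * ((ev * q) ^ n * V (h f 0))"
      using Suc ev pos q_bounds h[OF f] by (intro mult_mono V_nonneg) auto
    finally show ?case by (simp add: algebra_simps)
  qed simp
  \<comment> \<open>Since \<open>p (L u) = ev\<close>, the multiple of \<open>u\<close> leaves the
    normalised coefficient unchanged; only \<open>p (L (h f n))\<close> moves it, and that decays
    with \<open>V (h f n)\<close>.\<close>
  have t_step: "dist (t f n) (t f (Suc n)) \<le> (\<beta> / ev * V (h f 0)) * q ^ n" if f: "f \<in> X" for f n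
  proof -
    have "t f (Suc n) - t f n = p (L (h f n)) / (ev * ev ^ n)"
      using ev by (simp add: t_def pLh[OF f] field_simps)
    then have "dist (t f n) (t f (Suc n)) = \<bar>p (L (h f n))\<bar> / (ev * ev ^ n)"
      using ev by (subst dist_commute) (simp add: dist_real_def)
    also have "\<dots> \<le> (\<beta> * V (h f n)) / (ev * ev ^ n)"
      using p_L[OF h[OF f]] ev by (intro divide_right_mono) auto
    also have "\<dots> \<le> (\<beta> * ((ev * q) ^ n * V (h f 0))) / (ev * ev ^ n)"
      using V_h[OF f] ev pos by (intro divide_right_mono mult_left_mono) auto
    also have "\<dots> = (\<beta> / ev * V (h f 0)) * q ^ n"
      using ev by (simp add: power_mult_distrib)
    finally show ?thesis .
  qed
  have "\<exists>l. \<forall>n. \<bar>t f n - l\<bar> \<le> \<beta> / (ev * (1 - q)) * V (h f 0) * q ^ n" if f: "f \<in> X" for f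
  proof -
    obtain l where l: "\<And>n. dist (t f n) l \<le> \<beta> / ev * V (h f 0) / (1 - q) * q ^ n"
      using Met_TC.geometric_limit[of "t f" "\<beta> / ev * V (h f 0)" q] t_step[OF f] q_bounds complete_UNIV
      by (auto simp: less_imp_le)
    have "\<beta> / ev * V (h f 0) / (1 - q) = \<beta> / (ev * (1 - q)) * V (h f 0)"
      by simp
    then show ?thesis
      using l by (auto simp only: dist_real_def)
  qed
  then obtain l where l: "\<And>f n. f \<in> X \<Longrightarrow> \<bar>t f n - l f\<bar> \<le> \<beta> / (ev * (1 - q)) * V (h f 0) * q ^ n"
    by metis
  show ?thesis
    using that[of "\<beta> / (ev * (1 - q))" l] l V_h pos ev q_bounds by (simp add: h_def t_def)
qed

text \<open>The functional \<open>l\<close> is continuous with \<open>l u = 1\<close>, and composing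
  it with \<open>L\<close> multiplies it by \<open>ev\<close>; its kernel is therefore a closed
  invariant complement of \<open>u\<close>. On this kernel the error bound for the coefficients
  becomes a bound for the coefficients themselves.\<close>

theorem spectral_gap: "has_spectral_gap X N L"
proof -
  obtain u ev where u: "u \<in> B" and ev: "0 < ev" "\<kappa> + \<beta> * r \<le> ev * q" and Lu: "L u = ev *\<^sub>R u"
    by (rule eigenvector)
  obtain K l where K: "0 \<le> K"
    and V_h: "\<And>f n. f \<in> X \<Longrightarrow>
      V ((L ^^ n) f - p ((L ^^ n) f) *\<^sub>R u) \<le> (ev * q) ^ n * V (f - p f *\<^sub>R u)"
    and l: "\<And>f n. f \<in> X \<Longrightarrow> \<bar>p ((L ^^ n) f) / ev ^ n - l f\<bar> \<le> K * V (f - p f *\<^sub>R u) * q ^ n"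
    using dual_eigenfunctional[OF u ev Lu] by (metis (no_types, lifting))
  have uX: "u \<in> X" "p u = 1" "V u \<le> r"
    using u B_D by auto
  \<comment> \<open>Linearity, the eigenvalue equation and the normalisation of \<open>l\<close> all
    follow from this limit by uniqueness.\<close>
  have lim: "(\<lambda>n. p ((L ^^ n) f) / ev ^ n) \<longlonglongrightarrow> l f" if f: "f \<in> X" for f
  proof (rule LIM_zero_cancel)
    have "(\<lambda>n. K * V (f - p f *\<^sub>R u) * q ^ n) \<longlonglongrightarrow> 0"
      using q_bounds by (intro tendsto_mult_right_zero LIMSEQ_power_zero) simp
    then show "(\<lambda>n. p ((L ^^ n) f) / ev ^ n - l f) \<longlonglongrightarrow> 0"
      by (rule Lim_null_comparison[rotated]) (use l[OF f] in simp)
  qed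
  have l_add: "l (f + g) = l f + l g" if "f \<in> X" "g \<in> X" for f g
  proof (rule LIMSEQ_unique[OF lim])
    show "(\<lambda>n. p ((L ^^ n) (f + g)) / ev ^ n) \<longlonglongrightarrow> l f + l g"
      using tendsto_add[OF lim lim, OF that]
      by (simp add: iterate_add that p_add iterate_X add_divide_distrib)
  qed (use that in simp)
  have l_scale: "l (s *\<^sub>R f) = s * l f" if "f \<in> X" for f s
  proof (rule LIMSEQ_unique[OF lim])
    show "(\<lambda>n. p ((L ^^ n) (s *\<^sub>R f)) / ev ^ n) \<longlonglongrightarrow> s * l f"
      using tendsto_mult_left[OF lim, OF that, of s]
      by (simp add: iterate_scale that p_scale iterate_X)
  qed (use that in simp)
  have l_diff: "l (f - g) = l f - l g" if "f \<in> X" "g \<in> X" for f g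
    using l_add[of f "- 1 *\<^sub>R g"] l_scale[of g "- 1"] X_closed(3)[of g "- 1"] that by simp
  have l_L: "l (L f) = ev * l f" if "f \<in> X" for f
  proof (rule LIMSEQ_unique[OF lim])
    \<comment> \<open>Applying \<open>L\<close> first shifts the sequence by one index; the extra
      power of \<open>ev\<close> is the eigenvalue.\<close>
    have "(\<lambda>n. ev * (p ((L ^^ Suc n) f) / ev ^ Suc n)) \<longlonglongrightarrow> ev * l f"
      by (intro tendsto_mult_left LIMSEQ_Suc lim that)
    then show "(\<lambda>n. p ((L ^^ n) (L f)) / ev ^ n) \<longlonglongrightarrow> ev * l f"
      using ev by (simp add: funpow_swap1)
  qed (use that in simp)
  have l_u: "l u = 1"
  proof (rule LIMSEQ_unique[OF lim])
    have "(L ^^ n) u = ev ^ n *\<^sub>R u" for n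
      by (induction n) (simp_all add: L_scale uX Lu mult.commute)
    then show "(\<lambda>n. p ((L ^^ n) u) / ev ^ n) \<longlonglongrightarrow> 1"
      using ev uX by (simp add: p_scale)
  qed (rule uX)
  have V_Q: "V (f - p f *\<^sub>R u) \<le> (1 + r) * N f" if f: "f \<in> X" for f
  proof -
    have "V (f - p f *\<^sub>R u) \<le> V f + \<bar>p f\<bar> * V u"
      using V_diff[of f "p f *\<^sub>R u"] f uX by (simp add: V_scale)
    also have "\<dots> \<le> N f + N f * r"
      using V_le[OF f] p_le[OF f] N_nonneg[OF f] V_nonneg uX by (intro add_mono mult_mono) auto
    finally show ?thesis by (simp add: algebra_simps)
  qed
  \<comment> \<open>A bound for the norm of \<open>l\<close>, from the case \<open>n = 0\<close> of
    the error estimate together with \<open>V_Q\<close>.\<close>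
  define C' where "C' = 1 + K * (1 + r)"
  have C': "0 < C'"
    using K pos by (simp add: C'_def add_pos_nonneg)
  have l_le: "\<bar>l f\<bar> \<le> C' * N f" if f: "f \<in> X" for f
  proof -
    have "\<bar>l f\<bar> \<le> \<bar>p f\<bar> + K * V (f - p f *\<^sub>R u)"
      using l[OF f, of 0] by simp
    also have "\<dots> \<le> N f + K * ((1 + r) * N f)"
      using p_le[OF f] V_Q[OF f] K by (intro add_mono mult_left_mono)
    finally show ?thesis by (simp add: C'_def algebra_simps)
  qed
  define G where "G = {f \<in> X. l f = 0}"
  have l_0: "l 0 = 0"
    using l_scale[of 0 0] by simp
  have G_sub: "subspace G"
    by (auto simp: G_def subspace_def l_add l_scale l_0)
  have "closedin mtopology G"
    unfolding closedin_metric
  proof (intro conjI allI impI)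
    fix f assume f: "f \<in> X - G"
    \<comment> \<open>Any \<open>g\<close> in the kernel satisfies
      \<open>\<bar>l f\<bar> = \<bar>l (f - g)\<bar>\<close>, so its distance from \<open>f\<close>
      is at least this radius.\<close>
    have "disjnt G (mball f (\<bar>l f\<bar> / C'))"
      unfolding disjnt_iff
    proof (intro allI notI, elim conjE)
      fix g assume g: "g \<in> G" "g \<in> mball f (\<bar>l f\<bar> / C')"
      have "\<bar>l f\<bar> = \<bar>l (f - g)\<bar>"
        using f g by (simp add: G_def l_diff)
      also have "\<dots> \<le> C' * N (f - g)"
        using f g by (intro l_le) (auto simp: G_def)
      also have "\<dots> < C' * (\<bar>l f\<bar> / C')"
        using f g C' by (intro mult_strict_left_mono) (auto simp: G_def norm_dist_def)
      finally show False
        using C' by simp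
    qed
    then show "\<exists>\<rho>>0. disjnt G (mball f \<rho>)"
      using f C' by (intro exI[of _ "\<bar>l f\<bar> / C'"]) (auto simp: G_def)
  qed (auto simp: G_def)
  moreover have "{v + g | v g. v \<in> span {u} \<and> g \<in> G} = X"
  proof (intro equalityI subsetI)
    fix f assume "f \<in> X"
    then have "f - l f *\<^sub>R u \<in> G"
      using uX by (simp add: G_def l_diff l_scale l_u)
    moreover have "l f *\<^sub>R u \<in> span {u}"
      by (simp add: span_base span_scale)
    moreover have "f = l f *\<^sub>R u + (f - l f *\<^sub>R u)"
      by simp
    ultimately show "f \<in> {v + g | v g. v \<in> span {u} \<and> g \<in> G}"
      by blast
  qed (auto simp: G_def span_singleton uX)
  moreover have "span {u} \<inter> G = {0}"
    using uX l_scale[OF uX(1)] l_u l_0 by (auto simp: G_def span_singleton)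
  moreover have "L ` G \<subseteq> G"
    by (auto simp: G_def l_L)
  moreover have "u \<noteq> 0"
    using uX p_scale[OF uX(1), of 0] by auto
  \<comment> \<open>With \<open>D\<close> as below, the coefficient of the iterate is at most
    \<open>K * D * (ev * q) ^ n\<close> and its \<open>V\<close> at most
    \<open>(1 + K * r) * D * (ev * q) ^ n\<close>. \<open>N_le\<close> counts \<open>V\<close>
    twice, and \<open>D\<close> is at most \<open>(1 + r) * N g\<close>.\<close>
  moreover define C where "C = (K * (1 + 2 * r) + 2) * (1 + r)"
  moreover have C: "0 < C"
    using K pos by (simp add: C_def add_nonneg_pos)
  \<comment> \<open>The gap is \<open>1 - q\<close>.\<close>
  moreover have "onorm_on G N (L ^^ n) \<le> C * ev ^ n * (1 - (1 - q)) ^ n" for n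
    unfolding onorm_on_def
  proof (rule cSUP_least)
    show "G \<noteq> {}"
      using G_sub subspace_0 by blast
    fix g assume "g \<in> G"
    then have g: "g \<in> X" "l g = 0"
      by (auto simp: G_def)
    define g' where "g' = (L ^^ n) g"
    define D where "D = V (g - p g *\<^sub>R u)"
    have g': "g' \<in> X"
      using iterate_X g by (simp add: g'_def)
    have "\<bar>p g' / ev ^ n\<bar> \<le> K * D * q ^ n"
      using l[OF g(1), of n] g by (simp add: g'_def D_def)
    then have pg: "\<bar>p g'\<bar> \<le> K * D * (ev * q) ^ n"
      using ev by (simp add: abs_divide divide_le_eq power_mult_distrib mult_ac)
    have "V g' \<le> V (g' - p g' *\<^sub>R u) + \<bar>p g'\<bar> * V u"
      using V_add[of "g' - p g' *\<^sub>R u" "p g' *\<^sub>R u"] g' uX by (simp add: V_scale)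
    also have "\<dots> \<le> (ev * q) ^ n * D + (K * D * (ev * q) ^ n) * r"
      using V_h[OF g(1), of n] pg uX V_nonneg[OF uX(1)] order_trans[OF abs_ge_zero pg]
      by (intro add_mono mult_mono) (auto simp: g'_def D_def)
    finally have "N g' \<le> K * D * (ev * q) ^ n + 2 * ((ev * q) ^ n * D + (K * D * (ev * q) ^ n) * r)"
      by (rule order_trans[OF N_le[OF g'] add_mono[OF pg mult_left_mono[OF _ zero_le_numeral]]])
    also have "\<dots> = ((K * (1 + 2 * r) + 2) * (ev * q) ^ n) * D"
      by (simp add: algebra_simps)
    also have "\<dots> \<le> ((K * (1 + 2 * r) + 2) * (ev * q) ^ n) * ((1 + r) * N g)"
      using V_Q[OF g(1)] K pos ev q_bounds by (intro mult_left_mono) (auto simp: D_def)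
    also have "\<dots> = C * ev ^ n * (1 - (1 - q)) ^ n * N g"
      by (simp add: C_def power_mult_distrib)
    finally have "N g' \<le> C * ev ^ n * (1 - (1 - q)) ^ n * N g" .
    \<comment> \<open>If \<open>N g = 0\<close>, the quotient is 0 by the convention for
      division.\<close>
    then show "N ((L ^^ n) g) / N g \<le> C * ev ^ n * (1 - (1 - q)) ^ n"
      using N_nonneg[OF g(1)] C ev q_bounds
      by (cases "N g = 0") (auto simp: g'_def divide_le_eq)
  qed
  moreover have "0 < 1 - q" "1 - q < 1"
    using q_bounds by auto
  ultimately show ?thesis
    unfolding has_spectral_gap_def
    using banach bounded ev Lu uX(1) G_sub G_def
    by (intro conjI exI[of _ ev] bexI[of _ u] exI[of _ G] exI[of _ C] exI[of _ "1 - q"]) auto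
qed

end

section \<open>Functions of bounded variation\<close>

definition variation_sum :: "nat \<Rightarrow> (real \<Rightarrow> real) \<Rightarrow> (nat \<Rightarrow> real) \<Rightarrow> real"
  where "variation_sum n f x = (\<Sum>j=1..n. \<bar>f (x j) - f (x (j - 1))\<bar>)"

lemma variation_sum_0 [simp]: "variation_sum 0 f x = 0"
  by (simp add: variation_sum_def)

lemma variation_sum_Suc [simp]:
  "variation_sum (Suc n) f x = variation_sum n f x + \<bar>f (x (Suc n)) - f (x n)\<bar>"
  by (simp add: variation_sum_def)

lemma variation_sum_nonneg: "0 \<le> variation_sum n f x"
  by (simp add: variation_sum_def sum_nonneg)

lemma variation_sum_cong:
  "(\<And>j. j \<le> n \<Longrightarrow> x j = y j) \<Longrightarrow> variation_sum n f x = variation_sum n f y"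
  by (induction n) auto

lemma variation_sum_append:
  "variation_sum (m + n) f x = variation_sum m f x + variation_sum n f (\<lambda>j. x (m + j))"
  by (induction n) auto

text \<open>Needed for the decreasing branch. The last term of the reversed sum is the first term of
  the original one.\<close>

lemma variation_sum_rev:
  "variation_sum n f (\<lambda>j. x (n - j)) = variation_sum n f x"
proof (induction n arbitrary: x)
  case (Suc n)
  have "variation_sum (Suc n) f (\<lambda>j. x (Suc n - j)) = variation_sum n f (\<lambda>j. x (Suc (n - j))) + \<bar>f (x 0) - f (x 1)\<bar>"
    by (auto intro: variation_sum_cong simp: Suc_diff_le)
  also have "\<dots> = variation_sum n f (\<lambda>j. x (Suc j)) + \<bar>f (x 0) - f (x 1)\<bar>"
    using Suc[of "\<lambda>j. x (Suc j)"] by simp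
  also have "\<dots> = variation_sum (Suc n) f x"
    using variation_sum_append[of 1 n f x] by (simp add: abs_minus_commute)
  finally show ?case .
qed simp

lemma variation_sums_eq:
  "variation_sums a b f =
    {variation_sum n f x | n x. strict_mono_on {0..n} x \<and> x ` {0..n} \<subseteq> {a..b}}"
  by (simp add: variation_sums_def variation_sum_def)

lemma variation_sums_nonempty: "a \<le> b \<Longrightarrow> variation_sums a b f \<noteq> {}"
  unfolding variation_sums_eq
  by (auto intro!: exI[of _ "0::nat"] exI[of _ "\<lambda>_. a"] simp: strict_mono_on_def)

lemma strict_refinement:
  assumes "mono_on {0..n} (x :: nat \<Rightarrow> real)"
  obtains m y where "strict_mono_on {0..m} y" "y ` {0..m} \<subseteq> x ` {0..n}"
    "variation_sum m f y = variation_sum n f x"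
proof -
  \<comment> \<open>The equality \<open>y m = x n\<close> is added for the induction: the next point
    has to be compared with the last one kept.\<close>
  have "\<exists>m y. strict_mono_on {0..m} y \<and> y ` {0..m} \<subseteq> x ` {0..n} \<and> y m = x n \<and>
    variation_sum m f y = variation_sum n f x"
    using assms
  proof (induction n)
    case 0
    show ?case
      by (intro exI[of _ "0::nat"] exI[of _ x]) (auto simp: strict_mono_on_def)
  next
    case (Suc n)
    have "mono_on {0..n} x"
      using Suc.prems by (rule mono_on_subset) auto
    with Suc.IH obtain m y where y: "strict_mono_on {0..m} y" "y ` {0..m} \<subseteq> x ` {0..n}" "y m = x n"
      "variation_sum m f y = variation_sum n f x"
      by blast
    have le: "x n \<le> x (Suc n)"
      using mono_onD[OF Suc.prems, of n "Suc n"] by auto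
    show ?case
    proof (cases "x n = x (Suc n)")
      case True
      have "x ` {0..n} \<subseteq> x ` {0..Suc n}"
        by auto
      then show ?thesis
        using y True by (intro exI[of _ m] exI[of _ y]) auto
    next
      case False
      define z where "z = y(Suc m := x (Suc n))"
      have zy: "z j = y j" if "j \<le> m" for j
        using that by (simp add: z_def)
      have y_le: "y i \<le> x n" if "i \<le> m" for i
        using strict_mono_onD[OF y(1), of i m] y(3) that by (cases "i = m") auto
      have "z i < z j" if "i < j" "j \<le> Suc m" for i j
      proof (cases "j = Suc m")
        case True
        then show ?thesis
          using y_le[of i] le False that by (simp add: z_def)
      next
        case False
        then show ?thesis
          using strict_mono_onD[OF y(1), of i j] that zy by simp
      qed
      then have "strict_mono_on {0..Suc m} z"
        by (auto simp: strict_mono_on_def)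
      moreover have "z ` {0..Suc m} \<subseteq> x ` {0..Suc n}"
      proof -
        have "z ` {0..Suc m} = insert (x (Suc n)) (y ` {0..m})"
          using zy by (simp add: atLeast0_atMost_Suc z_def[THEN fun_cong, of "Suc m"])
        then show ?thesis
          using y(2) by (auto simp: atLeast0_atMost_Suc)
      qed
      moreover have "variation_sum (Suc m) f z = variation_sum (Suc n) f x"
        using variation_sum_cong[of m z y f] zy y by (simp add: z_def)
      moreover have "z (Suc m) = x (Suc n)"
        by (simp add: z_def)
      ultimately show ?thesis by blast
    qed
  qed
  then show ?thesis
    using that by blast
qed

section \<open>Total variation as a seminorm\<close>

lemma variation_sum_le:
  assumes f: "bounded_variation a b f"
    and x: "mono_on {0..n} x" "x ` {0..n} \<subseteq> {a..b}"
  shows "variation_sum n f x \<le> total_variation a b f"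
proof -
  obtain m y where y: "strict_mono_on {0..m} y" "y ` {0..m} \<subseteq> x ` {0..n}"
    "variation_sum m f y = variation_sum n f x"
    using strict_refinement[OF x(1)] by metis
  have "variation_sum m f y \<in> variation_sums a b f"
    using y x unfolding variation_sums_eq by blast
  then show ?thesis
    using f y by (simp add: bounded_variation_def total_variation_def cSup_upper)
qed

lemma bounded_variationI:
  assumes "a \<le> b"
    and "\<And>n x. strict_mono_on {0..n} x \<Longrightarrow> x ` {0..n} \<subseteq> {a..b} \<Longrightarrow> variation_sum n f x \<le> K"
  shows "bounded_variation a b f" "total_variation a b f \<le> K"
proof -
  have "s \<le> K" if "s \<in> variation_sums a b f" for s
    using that assms(2) by (auto simp: variation_sums_eq)
  then show "bounded_variation a b f" "total_variation a b f \<le> K"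
    using variation_sums_nonempty[OF assms(1)]
    by (auto simp: bounded_variation_def bdd_above_def total_variation_def intro!: cSup_least)
qed

lemma total_variation_nonneg:
  assumes "a \<le> b" "bounded_variation a b f"
  shows "0 \<le> total_variation a b f"
  using variation_sum_le[OF assms(2), of 0 "\<lambda>_. a"] assms by (simp add: monotone_on_def)

lemma abs_diff_le_total_variation:
  assumes f: "bounded_variation a b f" and "x \<in> {a..b}" "y \<in> {a..b}"
  shows "\<bar>f x - f y\<bar> \<le> total_variation a b f"
proof -
  have *: "\<bar>f x - f y\<bar> \<le> total_variation a b f" if "a \<le> x" "x \<le> y" "y \<le> b" for x y
  proof -
    define z where "z n = (if n = 0 then x else y)" for n :: nat
    have "mono_on {0..1} z" "z ` {0..1} \<subseteq> {a..b}"
      using that by (auto simp: monotone_on_def z_def)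
    then have "variation_sum 1 f z \<le> total_variation a b f"
      by (rule variation_sum_le[OF f])
    then show ?thesis
      by (simp add: z_def abs_minus_commute)
  qed
  show ?thesis
    using *[of x y] *[of y x] assms by (cases "x \<le> y") (auto simp: abs_minus_commute)
qed

text \<open>A bound on increments sums over any partition. Sums, multiples, products and the weight
  \<open>exp (\<phi> x)\<close> are all handled this way.\<close>

lemma bounded_variation_dominated:
  assumes "a \<le> b" and f: "bounded_variation a b f" and g: "bounded_variation a b g"
    and nn: "0 \<le> s" "0 \<le> t"
    and le: "\<And>x y. x \<in> {a..b} \<Longrightarrow> y \<in> {a..b} \<Longrightarrow> \<bar>h x - h y\<bar> \<le> s * \<bar>f x - f y\<bar> + t * \<bar>g x - g y\<bar>"
  shows "bounded_variation a b h"
    and "total_variation a b h \<le> s * total_variation a b f + t * total_variation a b g"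
proof -
  have "variation_sum n h x \<le> s * total_variation a b f + t * total_variation a b g"
    if x: "strict_mono_on {0..n} x" "x ` {0..n} \<subseteq> {a..b}" for n x
  proof -
    have "variation_sum n h x \<le> s * variation_sum n f x + t * variation_sum n g x"
      using x(2)
    proof (induction n)
      case (Suc n)
      have "x ` {0..n} \<subseteq> {a..b}" "x (Suc n) \<in> {a..b}" "x n \<in> {a..b}"
        using Suc.prems by (auto simp: image_subset_iff)
      then show ?case
        using Suc.IH le[of "x (Suc n)" "x n"] by (simp add: algebra_simps)
    qed simp
    also have "\<dots> \<le> s * total_variation a b f + t * total_variation a b g"
      using x nn strict_mono_on_imp_mono_on[OF x(1)]
      by (intro add_mono mult_left_mono variation_sum_le f g) auto
    finally show ?thesis .
  qed
  then show "bounded_variation a b h"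
    "total_variation a b h \<le> s * total_variation a b f + t * total_variation a b g"
    by (rule bounded_variationI[OF assms(1)]; blast)+
qed

lemma
  assumes "a \<le> b" "bounded_variation a b f" "bounded_variation a b g"
  shows bounded_variation_add: "bounded_variation a b (f + g)"
    and total_variation_add_le:
      "total_variation a b (f + g) \<le> total_variation a b f + total_variation a b g"
proof -
  have "\<bar>(f + g) x - (f + g) y\<bar> \<le> 1 * \<bar>f x - f y\<bar> + 1 * \<bar>g x - g y\<bar>" for x y
    by simp
  from bounded_variation_dominated[where h = "f + g", OF assms zero_le_one zero_le_one this]
  show "bounded_variation a b (f + g)"
    "total_variation a b (f + g) \<le> total_variation a b f + total_variation a b g"
    by simp_all
qed

lemma total_variation_const: "a \<le> b \<Longrightarrow> (\<And>x y. x \<in> {a..b} \<Longrightarrow> y \<in> {a..b} \<Longrightarrow> f x = f y) \<Longrightarrow>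
    bounded_variation a b f \<and> total_variation a b f = 0"
proof -
  assume ab: "a \<le> b" and c: "\<And>x y. x \<in> {a..b} \<Longrightarrow> y \<in> {a..b} \<Longrightarrow> f x = f y"
  have "variation_sum n f x \<le> 0" if "x ` {0..n} \<subseteq> {a..b}" for n x
    using that
  proof (induction n)
    case (Suc n)
    have "x ` {0..n} \<subseteq> {a..b}" "x (Suc n) \<in> {a..b}" "x n \<in> {a..b}"
      using Suc.prems by (auto simp: image_subset_iff)
    then show ?case
      using Suc.IH c[of "x (Suc n)" "x n"] by simp
  qed simp
  then have "bounded_variation a b f" "total_variation a b f \<le> 0"
    using bounded_variationI[OF ab, of f 0] by blast+
  then show ?thesis
    using total_variation_nonneg[OF ab] by (simp add: antisym)
qed

lemma
  assumes "a \<le> b" "bounded_variation a b f"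
  shows bounded_variation_scaleR: "bounded_variation a b (s *\<^sub>R f)"
    and total_variation_scaleR: "total_variation a b (s *\<^sub>R f) = \<bar>s\<bar> * total_variation a b f"
proof -
  have le: "bounded_variation a b (t *\<^sub>R g) \<and> total_variation a b (t *\<^sub>R g) \<le> \<bar>t\<bar> * total_variation a b g"
    if "bounded_variation a b g" for t and g :: "real \<Rightarrow> real"
    using bounded_variation_dominated[OF assms(1) that that, of "\<bar>t\<bar>" 0 "t *\<^sub>R g"]
    by (simp add: abs_mult flip: right_diff_distrib)
  then show bv: "bounded_variation a b (s *\<^sub>R f)"
    using assms by blast
  show "total_variation a b (s *\<^sub>R f) = \<bar>s\<bar> * total_variation a b f"
  proof (cases "s = 0")
    case True
    then show ?thesis using total_variation_const[OF assms(1), of "s *\<^sub>R f"] by simp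
  next
    case False
    \<comment> \<open>The reverse inequality comes from scaling back by
      \<open>1 / s\<close>.\<close>
    then show ?thesis
      using le[OF assms(2), of s] le[OF bv, of "1 / s"] by (simp add: abs_divide field_simps)
  qed
qed

lemma bounded_variation_mult:
  assumes ab: "a \<le> b" and f: "bounded_variation a b f" and g: "bounded_variation a b g"
    and F: "\<And>x. x \<in> {a..b} \<Longrightarrow> \<bar>f x\<bar> \<le> F" and G: "\<And>x. x \<in> {a..b} \<Longrightarrow> \<bar>g x\<bar> \<le> G"
  shows "bounded_variation a b (\<lambda>x. f x * g x)"
    and "total_variation a b (\<lambda>x. f x * g x) \<le> G * total_variation a b f + F * total_variation a b g"
proof -
  have FG: "0 \<le> F" "0 \<le> G"
    using F[of a] G[of a] ab by force+
  have le: "\<bar>f x * g x - f y * g y\<bar> \<le> G * \<bar>f x - f y\<bar> + F * \<bar>g x - g y\<bar>"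
    if "x \<in> {a..b}" "y \<in> {a..b}" for x y
  proof -
    \<comment> \<open>The discrete Leibniz rule.\<close>
    have "f x * g x - f y * g y = g x * (f x - f y) + f y * (g x - g y)"
      by (simp add: algebra_simps)
    then have "\<bar>f x * g x - f y * g y\<bar> \<le> \<bar>g x\<bar> * \<bar>f x - f y\<bar> + \<bar>f y\<bar> * \<bar>g x - g y\<bar>"
      by (metis abs_mult abs_triangle_ineq)
    also have "\<dots> \<le> G * \<bar>f x - f y\<bar> + F * \<bar>g x - g y\<bar>"
      using F G that by (intro add_mono mult_right_mono) auto
    finally show ?thesis .
  qed
  show "bounded_variation a b (\<lambda>x. f x * g x)"
    by (rule bounded_variation_dominated(1)[OF ab f g FG(2,1)]) (rule le)
  show "total_variation a b (\<lambda>x. f x * g x) \<le> G * total_variation a b f + F * total_variation a b g"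
    by (rule bounded_variation_dominated(2)[OF ab f g FG(2,1)]) (rule le)
qed

lemma abs_le_total_variation:
  assumes "bounded_variation a b f" "x \<in> {a..b}"
  shows "\<bar>f x\<bar> \<le> \<bar>f a\<bar> + total_variation a b f"
  using abs_diff_le_total_variation[OF assms, of a] assms(2) by fastforce

section \<open>The Banach space of functions of bounded variation\<close>

lemma BV_space_D:
  "f \<in> BV_space a b \<Longrightarrow> bounded_variation a b f"
  "f \<in> BV_space a b \<Longrightarrow> x \<notin> {a..b} \<Longrightarrow> f x = 0"
  by (auto simp: BV_space_def)

lemma
  assumes "a \<le> b" and f: "f \<in> BV_space a b"
  shows abs_le_BV_norm: "x \<in> {a..b} \<Longrightarrow> \<bar>f x\<bar> \<le> BV_norm a b f"
    and total_variation_le_BV_norm: "total_variation a b f \<le> BV_norm a b f"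
    and BV_norm_le: "(\<And>x. x \<in> {a..b} \<Longrightarrow> \<bar>f x\<bar> \<le> K) \<Longrightarrow> BV_norm a b f \<le> K + total_variation a b f"
proof -
  note bv = BV_space_D(1)[OF f]
  have bdd: "bdd_above ((\<lambda>x. \<bar>f x\<bar>) ` {a..b})"
    by (rule bdd_aboveI2[OF abs_le_total_variation[OF bv]])
  have up: "\<bar>f x\<bar> \<le> (SUP x\<in>{a..b}. \<bar>f x\<bar>)" if "x \<in> {a..b}" for x
    using bdd that by (rule cSUP_upper2) simp
  show "\<bar>f x\<bar> \<le> BV_norm a b f" if "x \<in> {a..b}"
    using up[OF that] total_variation_nonneg[OF assms(1) bv] by (simp add: BV_norm_def)
  show "total_variation a b f \<le> BV_norm a b f"
    using up[of a] assms(1) by (simp add: BV_norm_def)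
  show "BV_norm a b f \<le> K + total_variation a b f" if "\<And>x. x \<in> {a..b} \<Longrightarrow> \<bar>f x\<bar> \<le> K"
    using assms(1) that by (auto simp: BV_norm_def intro: cSUP_least)
qed

lemma BV_norm_le_twice_variation:
  assumes "a \<le> b" "f \<in> BV_space a b"
  shows "BV_norm a b f \<le> \<bar>f a\<bar> + 2 * total_variation a b f"
  using BV_norm_le[OF assms abs_le_total_variation[OF BV_space_D(1)[OF assms(2)]]] by simp

lemma subspace_BV_space:
  assumes "a \<le> b"
  shows "subspace (BV_space a b)"
  unfolding subspace_def BV_space_def
  using bounded_variation_add[OF assms] bounded_variation_scaleR[OF assms]
    total_variation_const[OF assms, of 0]
  by simp

lemma norm_on_BV_norm:
  assumes ab: "a \<le> b"
  shows "norm_on (BV_space a b) (BV_norm a b)"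
  unfolding norm_on_def
proof (intro conjI ballI allI)
  fix f assume f: "f \<in> BV_space a b"
  show nn: "0 \<le> BV_norm a b f"
    using abs_le_BV_norm[OF ab f, of a] ab by simp
  show "BV_norm a b f = 0 \<longleftrightarrow> f = 0"
  proof
    assume 0: "BV_norm a b f = 0"
    \<comment> \<open>Off the interval this is the convention of extension by zero.\<close>
    have "f x = 0" for x
      using abs_le_BV_norm[OF ab f, of x] BV_space_D(2)[OF f, of x] 0 by (cases "x \<in> {a..b}") auto
    then show "f = 0" by auto
  next
    assume "f = 0"
    then show "BV_norm a b f = 0"
      using BV_norm_le[OF ab f, of 0] total_variation_const[OF ab, of f] nn by simp
  qed
  have scale: "BV_norm a b (s *\<^sub>R g) = \<bar>s\<bar> * BV_norm a b g" if g: "g \<in> BV_space a b" for s g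
  proof -
    have le: "BV_norm a b (t *\<^sub>R h) \<le> \<bar>t\<bar> * BV_norm a b h" if h: "h \<in> BV_space a b" for t h
    proof -
      \<comment> \<open>The difference of \<open>BV_norm\<close> and \<open>total_variation\<close>
        is just the supremum of \<open>\<bar>h x\<bar>\<close>.\<close>
      have "BV_norm a b (t *\<^sub>R h) \<le> \<bar>t\<bar> * (BV_norm a b h - total_variation a b h) + total_variation a b (t *\<^sub>R h)"
      proof (rule BV_norm_le[OF ab])
        fix x assume x: "x \<in> {a..b}"
        have "bdd_above ((\<lambda>x. \<bar>h x\<bar>) ` {a..b})"
          by (rule bdd_aboveI2[OF abs_le_BV_norm[OF ab h]])
        then have "\<bar>h x\<bar> \<le> BV_norm a b h - total_variation a b h"
          using x by (auto simp: BV_norm_def intro: cSUP_upper2)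
        then show "\<bar>(t *\<^sub>R h) x\<bar> \<le> \<bar>t\<bar> * (BV_norm a b h - total_variation a b h)"
          by (simp add: abs_mult mult_left_mono)
      qed (use subspace_scale[OF subspace_BV_space[OF ab] h] in blast)
      then show ?thesis
        using total_variation_scaleR[OF ab BV_space_D(1)[OF h], of t] by (simp add: algebra_simps)
    qed
    show ?thesis
    proof (cases "s = 0")
      case True
      have "0 \<le> BV_norm a b (s *\<^sub>R g)"
        using abs_le_BV_norm[OF ab subspace_scale[OF subspace_BV_space[OF ab] g], of a s] ab by force
      then show ?thesis using le[OF g, of s] True by simp
    next
      case False
      then show ?thesis
        using le[OF g, of s] le[OF subspace_scale[OF subspace_BV_space[OF ab] g, of s], of "1 / s"]
        by (simp add: abs_divide field_simps)
    qed
  qed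
  show "BV_norm a b (s *\<^sub>R f) = \<bar>s\<bar> * BV_norm a b f" for s
    by (rule scale[OF f])
  fix g assume g: "g \<in> BV_space a b"
  have bdd: "bdd_above ((\<lambda>x. \<bar>h x\<bar>) ` {a..b})" if "h \<in> BV_space a b" for h
    by (rule bdd_aboveI2[OF abs_le_BV_norm[OF ab that]])
  have "BV_norm a b (f + g) \<le>
    ((SUP x\<in>{a..b}. \<bar>f x\<bar>) + (SUP x\<in>{a..b}. \<bar>g x\<bar>)) + total_variation a b (f + g)"
  proof (rule BV_norm_le[OF ab])
    fix x assume "x \<in> {a..b}"
    then have "\<bar>f x\<bar> \<le> (SUP x\<in>{a..b}. \<bar>f x\<bar>)" "\<bar>g x\<bar> \<le> (SUP x\<in>{a..b}. \<bar>g x\<bar>)"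
      using cSUP_upper[OF _ bdd] f g by blast+
    then show "\<bar>(f + g) x\<bar> \<le> (SUP x\<in>{a..b}. \<bar>f x\<bar>) + (SUP x\<in>{a..b}. \<bar>g x\<bar>)"
      by simp
  qed (use subspace_add[OF subspace_BV_space[OF ab] f g] in blast)
  then show "BV_norm a b (f + g) \<le> BV_norm a b f + BV_norm a b g"
    using total_variation_add_le[OF ab BV_space_D(1)[OF f] BV_space_D(1)[OF g]]
    by (simp add: BV_norm_def)
qed

text \<open>Only finitely many values enter, so pointwise convergence suffices; this is what makes
  bounds on the variation pass to pointwise limits.\<close>

lemma variation_sum_tendsto:
  assumes "\<And>x. (\<lambda>m. g m x) \<longlonglongrightarrow> f x"
  shows "(\<lambda>m. variation_sum n (g m) x) \<longlonglongrightarrow> variation_sum n f x"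
  unfolding variation_sum_def by (intro tendsto_intros assms)

text \<open>A Cauchy sequence converges pointwise. Letting \<open>m\<close> tend to infinity in the
  bounds for \<open>\<sigma> m - \<sigma> n\<close>, at each point and for each partition, shows
  that the pointwise limit is the limit in norm.\<close>

theorem banach_on_BV_space:
  assumes ab: "a \<le> b"
  shows "banach_on (BV_space a b) (BV_norm a b)"
proof -
  let ?X = "BV_space a b" and ?N = "BV_norm a b"
  note sub = subspace_BV_space[OF ab]
  interpret Metric_space ?X "norm_dist ?X ?N"
    by (rule Metric_space_norm_dist[OF sub norm_on_BV_norm[OF ab]])
  have mcomplete
    unfolding mcomplete_def
  proof (intro allI impI)
    fix \<sigma> assume "MCauchy \<sigma>"
    then have \<sigma>: "\<sigma> n \<in> ?X" for n
      by (auto simp: MCauchy_def)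
    have Cauchy: "\<exists>M. \<forall>n\<ge>M. \<forall>m\<ge>M. ?N (\<sigma> m - \<sigma> n) < \<epsilon>" if "0 < \<epsilon>" for \<epsilon>
    proof -
      have "\<forall>\<epsilon>>0. \<exists>M. \<forall>n m. M \<le> n \<longrightarrow> M \<le> m \<longrightarrow> norm_dist ?X ?N (\<sigma> n) (\<sigma> m) < \<epsilon>"
        using \<open>MCauchy \<sigma>\<close> unfolding MCauchy_def by (rule conjunct2)
      from this[rule_format, OF that] obtain M
        where "\<forall>n m. M \<le> n \<longrightarrow> M \<le> m \<longrightarrow> norm_dist ?X ?N (\<sigma> n) (\<sigma> m) < \<epsilon>" ..
      then show ?thesis
        using \<sigma> by (intro exI[of _ M]) (simp add: norm_dist_def)
    qed
    have diff: "\<sigma> m - \<sigma> n \<in> ?X" for m n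
      using subspace_diff[OF sub] \<sigma> by blast
    have pointwise: "\<bar>\<sigma> m x - \<sigma> n x\<bar> \<le> ?N (\<sigma> m - \<sigma> n)" for m n x
    proof (cases "x \<in> {a..b}")
      case True
      then show ?thesis using abs_le_BV_norm[OF ab diff[of m n], of x] by simp
    next
      case False
      then show ?thesis
        using BV_space_D(2)[OF \<sigma>] abs_le_BV_norm[OF ab diff[of m n], of a] ab by simp
    qed
    have Cauchy_at: "Cauchy (\<lambda>n. \<sigma> n x)" for x
    proof (rule metric_CauchyI)
      fix \<epsilon> :: real assume "0 < \<epsilon>"
      from Cauchy[OF this] obtain M where M: "\<forall>n\<ge>M. \<forall>m\<ge>M. ?N (\<sigma> m - \<sigma> n) < \<epsilon>" ..
      have "dist (\<sigma> m x) (\<sigma> n x) < \<epsilon>" if "M \<le> m" "M \<le> n" for m n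
        using le_less_trans[OF pointwise[of m x n]] M that by (simp add: dist_real_def)
      then show "\<exists>M. \<forall>m\<ge>M. \<forall>n\<ge>M. dist (\<sigma> m x) (\<sigma> n x) < \<epsilon>" by blast
    qed
    define f where "f x = lim (\<lambda>n. \<sigma> n x)" for x
    have f: "(\<lambda>n. \<sigma> n x) \<longlonglongrightarrow> f x" for x
      unfolding f_def using Cauchy_convergent[OF Cauchy_at] by (simp only: convergent_LIMSEQ_iff)
    have lim: "(\<lambda>m. (\<sigma> m - \<sigma> n) x) \<longlonglongrightarrow> (f - \<sigma> n) x" for n x
      using tendsto_diff[OF f tendsto_const] by simp
    \<comment> \<open>One \<epsilon> for the supremum and one for the variation.\<close>
    have close: "f - \<sigma> n \<in> ?X \<and> ?N (f - \<sigma> n) \<le> \<epsilon> + \<epsilon>"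
      if M: "\<forall>m\<ge>M. ?N (\<sigma> m - \<sigma> n) < \<epsilon>" for n M \<epsilon>
    proof -
      have 1: "\<bar>(f - \<sigma> n) x\<bar> \<le> \<epsilon>" for x
      proof (rule LIMSEQ_le_const2[OF tendsto_rabs[OF lim]])
        show "\<exists>M. \<forall>m\<ge>M. \<bar>(\<sigma> m - \<sigma> n) x\<bar> \<le> \<epsilon>"
          using order_trans[OF pointwise[of _ x n] less_imp_le] M by (intro exI[of _ M]) simp
      qed
      have 2: "variation_sum k (f - \<sigma> n) x \<le> \<epsilon>"
        if x: "strict_mono_on {0..k} x" "x ` {0..k} \<subseteq> {a..b}" for k x
      proof (rule LIMSEQ_le_const2[OF variation_sum_tendsto[OF lim]])
        have "variation_sum k (\<sigma> m - \<sigma> n) x \<le> \<epsilon>" if "M \<le> m" for m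
        proof -
          have "variation_sum k (\<sigma> m - \<sigma> n) x \<le> total_variation a b (\<sigma> m - \<sigma> n)"
            by (rule variation_sum_le[OF BV_space_D(1)[OF diff] strict_mono_on_imp_mono_on[OF x(1)] x(2)])
          also have "\<dots> \<le> ?N (\<sigma> m - \<sigma> n)"
            by (rule total_variation_le_BV_norm[OF ab diff])
          finally show ?thesis
            using M that by (simp add: less_imp_le order.strict_trans1)
        qed
        then show "\<exists>M. \<forall>m\<ge>M. variation_sum k (\<sigma> m - \<sigma> n) x \<le> \<epsilon>" by blast
      qed
      note tv = bounded_variationI[where f = "f - \<sigma> n" and K = \<epsilon>, OF ab 2]
      have "(f - \<sigma> n) x = 0" if "x \<notin> {a..b}" for x
        using LIMSEQ_unique[OF f[of x]] BV_space_D(2)[OF \<sigma> that] by simp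
      then have X: "f - \<sigma> n \<in> ?X"
        using tv(1) by (simp add: BV_space_def)
      moreover have "?N (f - \<sigma> n) \<le> \<epsilon> + total_variation a b (f - \<sigma> n)"
        by (rule BV_norm_le[OF ab X 1])
      ultimately show ?thesis
        using tv(2) by simp
    qed
    have "f \<in> ?X"
    proof -
      obtain M where "\<forall>n\<ge>M. \<forall>m\<ge>M. ?N (\<sigma> m - \<sigma> n) < 1"
        using Cauchy[of 1] by auto
      then have "f - \<sigma> M \<in> ?X"
        using close[of M M 1] by auto
      then show ?thesis
        using subspace_add[OF sub _ \<sigma>, of "f - \<sigma> M" M] by simp
    qed
    moreover have "\<exists>M. \<forall>n\<ge>M. norm_dist ?X ?N (\<sigma> n) f < \<epsilon>" if pos: "0 < \<epsilon>" for \<epsilon>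
    proof -
      obtain M where M: "\<forall>n\<ge>M. \<forall>m\<ge>M. ?N (\<sigma> m - \<sigma> n) < \<epsilon> / 3"
        using Cauchy[of "\<epsilon> / 3"] pos by auto
      have "norm_dist ?X ?N f (\<sigma> n) < \<epsilon>" if n: "M \<le> n" for n
      proof -
        have "?N (f - \<sigma> n) \<le> \<epsilon> / 3 + \<epsilon> / 3"
          by (rule conjunct2[OF close[of M]]) (use M n in simp)
        then show ?thesis
          using pos by (simp add: norm_dist_def)
      qed
      then show ?thesis
        by (subst commute) blast
    qed
    ultimately show "\<exists>f. limitin mtopology \<sigma> f sequentially"
      using \<sigma> by (intro exI[of _ f]) (simp add: limitin_metric eventually_sequentially)
  qed
  then show ?thesis
    using sub norm_on_BV_norm[OF ab] by (simp add: banach_on_def)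
qed

section \<open>The transfer operator of a unimodal map\<close>

text \<open>
  Going up one branch and down the other traverses a single partition, so the two compositions
  share the variation of \<open>f\<close>.
\<close>

lemma variation_sum_branches_le:
  assumes f: "bounded_variation a b f"
    and b1: "mono_on {a..b} b1" "\<And>x. x \<in> {a..b} \<Longrightarrow> b1 x \<in> {a..c}"
    and b2: "antimono_on {a..b} b2" "\<And>x. x \<in> {a..b} \<Longrightarrow> b2 x \<in> {c..b}"
    and x: "mono_on {0..n} x" "x ` {0..n} \<subseteq> {a..b}"
  shows "variation_sum n f (\<lambda>j. b1 (x j)) + variation_sum n f (\<lambda>j. b2 (x j)) \<le> total_variation a b f"
proof -
  \<comment> \<open>These are \<open>2 * n + 2\<close> points: the images under \<open>b1\<close> in
    order, then those under \<open>b2\<close> in reverse order. They increase because the ranges of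
    the branches are separated by \<open>c\<close>.\<close>
  define z where "z j = (if j \<le> n then b1 (x j) else b2 (x (2 * n + 1 - j)))" for j
  have xI: "x j \<in> {a..b}" if "j \<le> n" for j
    using x(2) that by (auto simp: image_subset_iff)
  have b1I: "b1 (x j) \<in> {a..c}" and b2I: "b2 (x j) \<in> {c..b}" if "j \<le> n" for j
    using b1(2) b2(2) xI[OF that] by blast+
  have "z i \<le> z j" if "i \<le> j" "j \<le> n + (1 + n)" for i j
  proof (cases "j \<le> n")
    case True
    then show ?thesis
      using that mono_onD[OF x(1), of i j] mono_onD[OF b1(1) xI xI, of i j] by (simp add: z_def)
  next
    case j: False
    show ?thesis
    proof (cases "i \<le> n")
      case True
      then show ?thesis
        using j that b1I[OF True] b2I[of "2 * n + 1 - j"] by (auto simp: z_def intro: order_trans)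
    next
      case False
      have "x (2 * n + 1 - j) \<le> x (2 * n + 1 - i)"
        using j False that by (intro mono_onD[OF x(1)]) auto
      then have "b2 (x (2 * n + 1 - i)) \<le> b2 (x (2 * n + 1 - j))"
        using j False that by (intro monotone_onD[OF b2(1)] xI) auto
      then show ?thesis
        using j False by (simp add: z_def)
    qed
  qed
  then have mono: "mono_on {0..n + (1 + n)} z"
    by (auto simp: monotone_on_def)
  have "z j \<in> {a..b}" if "j \<le> n + (1 + n)" for j
  proof (cases "j \<le> n")
    case True
    then show ?thesis
      using b1I[of j] b2I[of 0] by (auto simp: z_def)
  next
    case False
    then have "2 * n + 1 - j \<le> n"
      by simp
    then show ?thesis
      using False b1I[of 0] b2I[of "2 * n + 1 - j"] by (auto simp: z_def)
  qed
  then have "variation_sum (n + (1 + n)) f z \<le> total_variation a b f"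
    by (intro variation_sum_le[OF f mono]) auto
  \<comment> \<open>The middle piece is the single jump from \<open>b1 (x n)\<close> to
    \<open>b2 (x n)\<close>; being nonnegative it can be discarded.\<close>
  moreover have "variation_sum (n + (1 + n)) f z =
    variation_sum n f z + (variation_sum 1 f (\<lambda>j. z (n + j)) + variation_sum n f (\<lambda>j. z (n + (1 + j))))"
    by (simp only: variation_sum_append)
  moreover have "variation_sum n f z = variation_sum n f (\<lambda>j. b1 (x j))"
    by (rule variation_sum_cong) (simp add: z_def)
  moreover have "variation_sum n f (\<lambda>j. z (n + (1 + j))) = variation_sum n f (\<lambda>j. b2 (x j))"
  proof -
    have "variation_sum n f (\<lambda>j. z (n + (1 + j))) = variation_sum n f (\<lambda>j. b2 (x (n - j)))"
      by (rule variation_sum_cong) (simp add: z_def mult_2)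
    also have "\<dots> = variation_sum n f (\<lambda>j. b2 (x j))"
      by (rule variation_sum_rev)
    finally show ?thesis .
  qed
  ultimately show ?thesis
    using variation_sum_nonneg[of 1 f "\<lambda>j. z (n + j)"] by linarith
qed

lemma abs_midpoint_diff_le:
  fixes p q r s :: real
  shows "\<bar>1/2 * (p + q) - 1/2 * (r + s)\<bar> \<le> 1/2 * (\<bar>p - r\<bar> + \<bar>q - s\<bar>)"
proof -
  have "1/2 * (p + q) - 1/2 * (r + s) = 1/2 * ((p - r) + (q - s))"
    by (simp add: algebra_simps)
  then show ?thesis
    using abs_triangle_ineq[of "p - r" "q - s"] by (simp only: abs_mult) simp
qed

section \<open>Inverse branches and the halving of the variation\<close>

locale unimodal_map =
  fixes a c b :: real and T :: "real \<Rightarrow> real"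
  assumes ac: "a < c" and cb: "c < b"
    and T_inc: "strict_mono_on {a..c} T" "T ` {a..c} = {a..b}"
    and T_dec: "strict_antimono_on {c..b} T" "T ` {c..b} = {a..b}"
begin

lemma ab: "a \<le> b"
  using ac cb by simp

abbreviation "b1 \<equiv> the_inv_into {a..c} T"
abbreviation "b2 \<equiv> the_inv_into {c..b} T"

lemma inj: "inj_on T {a..c}" "inj_on T {c..b}"
proof -
  show "inj_on T {a..c}"
    by (rule strict_mono_on_imp_inj_on[OF T_inc(1)])
  show "inj_on T {c..b}"
  proof (rule linorder_inj_onI)
    fix x y assume "x < y" "x \<in> {c..b}" "y \<in> {c..b}"
    then have "T y < T x"
      by (intro monotone_onD[OF T_dec(1)])
    then show "T x \<noteq> T y" by simp
  qed auto
qed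

lemma b1_range: "x \<in> {a..b} \<Longrightarrow> b1 x \<in> {a..c}"
  by (rule the_inv_into_into[OF inj(1) _ order_refl], simp only: T_inc)

lemma b2_range: "x \<in> {a..b} \<Longrightarrow> b2 x \<in> {c..b}"
  by (rule the_inv_into_into[OF inj(2) _ order_refl], simp only: T_dec)

lemma branch_mem:
  assumes "x \<in> {a..b}"
  shows "b1 x \<in> {a..b}" "b2 x \<in> {a..b}"
  using b1_range[OF assms] b2_range[OF assms] ac cb by auto

lemma T_b1: "x \<in> {a..b} \<Longrightarrow> T (b1 x) = x"
  by (rule f_the_inv_into_f[OF inj(1)], simp only: T_inc)

lemma T_b2: "x \<in> {a..b} \<Longrightarrow> T (b2 x) = x"
  by (rule f_the_inv_into_f[OF inj(2)], simp only: T_dec)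

lemma b1_mono: "mono_on {a..b} b1"
proof (rule mono_onI, rule ccontr)
  fix x y assume xy: "x \<in> {a..b}" "y \<in> {a..b}" "x \<le> y" "\<not> b1 x \<le> b1 y"
  then have "T (b1 y) < T (b1 x)"
    by (intro strict_mono_onD[OF T_inc(1)] b1_range) auto
  then show False
    using xy by (simp add: T_b1)
qed

lemma b2_antimono: "antimono_on {a..b} b2"
proof (rule monotone_onI, rule ccontr)
  fix x y assume xy: "x \<in> {a..b}" "y \<in> {a..b}" "x \<le> y" "\<not> b2 y \<le> b2 x"
  then have "T (b2 y) < T (b2 x)"
    by (intro monotone_onD[OF T_dec(1)] b2_range) auto
  then show False
    using xy by (simp add: T_b2)
qed

lemma transfer_operator_eq:
  "x \<in> {a..b} \<Longrightarrow> transfer_operator a c b T \<phi> f x =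
    1/2 * (exp (\<phi> (b1 x)) * f (b1 x) + exp (\<phi> (b2 x)) * f (b2 x))"
  "x \<notin> {a..b} \<Longrightarrow> transfer_operator a c b T \<phi> f x = 0"
  by (auto simp: transfer_operator_def Let_def)

text \<open>The image of \<open>f\<close> is the average of the weighted function composed with both
  branches. These compositions share one total variation instead of each using a full one, so the
  factor 1/2 survives.\<close>

lemma transfer_operator_variation:
  assumes f: "bounded_variation a b (\<lambda>x. exp (\<phi> x) * f x)"
  shows "transfer_operator a c b T \<phi> f \<in> BV_space a b"
    and "total_variation a b (transfer_operator a c b T \<phi> f) \<le>
      1/2 * total_variation a b (\<lambda>x. exp (\<phi> x) * f x)"
proof -
  define F where "F x = exp (\<phi> x) * f x" for x
  define Lf where "Lf = transfer_operator a c b T \<phi> f"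
  have "variation_sum n Lf x \<le> 1/2 * total_variation a b F"
    if x: "strict_mono_on {0..n} x" "x ` {0..n} \<subseteq> {a..b}" for n x
  proof -
    have Lf: "Lf y = 1/2 * (F (b1 y) + F (b2 y))" if "y \<in> {a..b}" for y
      using that by (simp add: Lf_def F_def transfer_operator_eq)
    have "variation_sum n Lf x \<le>
      1/2 * (variation_sum n F (\<lambda>j. b1 (x j)) + variation_sum n F (\<lambda>j. b2 (x j)))"
      using x(2)
    proof (induction n)
      case (Suc n)
      have xI: "x ` {0..n} \<subseteq> {a..b}" "x (Suc n) \<in> {a..b}" "x n \<in> {a..b}"
        using Suc.prems by (auto simp: image_subset_iff)
      have "\<bar>Lf (x (Suc n)) - Lf (x n)\<bar> \<le>
        1/2 * (\<bar>F (b1 (x (Suc n))) - F (b1 (x n))\<bar> + \<bar>F (b2 (x (Suc n))) - F (b2 (x n))\<bar>)"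
        unfolding Lf[OF xI(2)] Lf[OF xI(3)] by (rule abs_midpoint_diff_le)
      from add_mono[OF Suc.IH[OF xI(1)] this] show ?case
        by (simp add: algebra_simps)
    qed simp
    also have "\<dots> \<le> 1/2 * total_variation a b F"
      using variation_sum_branches_le[OF f[folded F_def] b1_mono b1_range b2_antimono b2_range
          strict_mono_on_imp_mono_on[OF x(1)] x(2)]
      by simp
    finally show ?thesis .
  qed
  note tv = bounded_variationI[where f = Lf and K = "1/2 * total_variation a b F", OF ab this]
  show "transfer_operator a c b T \<phi> f \<in> BV_space a b"
    using tv(1) by (simp add: BV_space_def transfer_operator_eq(2) Lf_def)
  show "total_variation a b (transfer_operator a c b T \<phi> f) \<le>
    1/2 * total_variation a b (\<lambda>x. exp (\<phi> x) * f x)"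
    using tv(2) unfolding Lf_def F_def .
qed

lemma transfer_operator_abs_le:
  assumes "\<And>x. x \<in> {a..b} \<Longrightarrow> exp (\<phi> x) \<le> M" "\<And>x. x \<in> {a..b} \<Longrightarrow> \<bar>f x\<bar> \<le> K" "x \<in> {a..b}"
  shows "\<bar>transfer_operator a c b T \<phi> f x\<bar> \<le> M * K"
proof -
  have *: "\<bar>exp (\<phi> y) * f y\<bar> \<le> M * K" if "y \<in> {a..b}" for y
    using assms(1,2)[OF that] order_trans[OF exp_ge_zero assms(1)[OF that]]
    by (simp add: abs_mult mult_mono)
  show ?thesis
    using *[OF branch_mem(1)[OF assms(3)]] *[OF branch_mem(2)[OF assms(3)]] assms(3)
    by (simp add: transfer_operator_eq)
qed

end

section \<open>Numerical estimates for a potential of small variation\<close>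

lemma exp_diff_le:
  fixes s t :: real
  assumes "exp s \<le> M" "exp t \<le> M"
  shows "\<bar>exp s - exp t\<bar> \<le> M * \<bar>s - t\<bar>"
proof -
  have *: "exp s - exp t \<le> M * \<bar>s - t\<bar>" if "exp s \<le> M" for s t :: real
  proof (cases "t \<le> s")
    case True
    \<comment> \<open>Factoring out the larger exponential reduces the claim to
      \<open>1 + x \<le> exp x\<close>.\<close>
    have "exp s - exp t = exp s * (1 - exp (t - s))"
      by (simp add: exp_diff field_simps)
    also have "\<dots> \<le> exp s * (s - t)"
    proof (rule mult_left_mono)
      show "1 - exp (t - s) \<le> s - t"
        using exp_ge_add_one_self[of "t - s"] by linarith
    qed simp
    also have "\<dots> \<le> M * (s - t)"
      using True that by (intro mult_right_mono) auto
    finally show ?thesis using True by simp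
  next
    case False
    then have "exp s - exp t \<le> 0" by simp
    moreover have "0 \<le> M" using that exp_ge_zero order_trans by blast
    ultimately show ?thesis by (meson abs_ge_zero mult_nonneg_nonneg order_trans)
  qed
  show ?thesis
    using *[OF assms(1), of t] *[OF assms(2), of s] by (simp add: abs_minus_commute abs_le_iff)
qed

theorem theorem1p3:
  fixes a b c :: real and T \<phi> :: "real \<Rightarrow> real"
  assumes "a < c" and "c < b"
    and "T \<in> {a..b} \<rightarrow> {a..b}" and "continuous_on {a..b} T"
    and "strict_mono_on {a..c} T" and "T ` {a..c} = {a..b}"
    and "strict_antimono_on {c..b} T" and "T ` {c..b} = {a..b}"
    and "bounded_variation a b \<phi>" and "total_variation a b \<phi> \<le> 0.0069"
  shows "has_spectral_gap (BV_space a b) (BV_norm a b) (transfer_operator a c b T \<phi>)"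
proof -
  interpret unimodal_map a c b T
    by unfold_locales (rule assms)+
  let ?X = "BV_space a b" and ?N = "BV_norm a b" and ?V = "total_variation a b"
  define L where "L = transfer_operator a c b T \<phi>"
  define w where "w x = exp (\<phi> x)" for x
  \<comment> \<open>\<open>M\<close> bounds the weight from above. All constants below are multiples
    of \<open>M\<close>, so its size does not matter.\<close>
  define M where "M = exp (\<phi> a + 0.0069)"
  \<comment> \<open>The constant 1 in the representation by zero extension.\<close>
  define e :: "real \<Rightarrow> real" where "e = indicator {a..b}"
  have M: "0 < M" by (simp add: M_def)
  have aI: "a \<in> {a..b}" using ab by simp
  have osc: "\<bar>\<phi> x - \<phi> a\<bar> \<le> 0.0069" if "x \<in> {a..b}" for x
    using abs_diff_le_total_variation[OF assms(9) that aI] assms(10) by linarith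
  have w_le: "w x \<le> M" if "x \<in> {a..b}" for x
    unfolding w_def M_def exp_le_cancel_iff using osc[OF that] by linarith
  \<comment> \<open>The potential stays within 0.0069 of its value at \<open>a\<close>, so the ratio
    of the weight to \<open>M\<close> is at least \<open>exp (- 0.0138)\<close>, hence at least
    \<open>1 - 0.0138\<close>.\<close>
  have w_ge: "0.98 * M \<le> w x" if "x \<in> {a..b}" for x
  proof -
    have "0.98 * M \<le> exp (- 0.0138) * M"
    proof (rule mult_right_mono)
      show "0.98 \<le> exp (- 0.0138 :: real)"
        by (rule order_trans[OF _ exp_ge_add_one_self]) simp
    qed (use M in simp)
    also have "\<dots> = exp (\<phi> a - 0.0069)"
      by (simp add: M_def flip: exp_add)
    also have "\<dots> \<le> w x"
      unfolding w_def exp_le_cancel_iff using osc[OF that] by linarith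
    finally show ?thesis .
  qed
  have w_abs: "\<bar>w x\<bar> \<le> M" if "x \<in> {a..b}" for x
    using w_le[OF that] by (simp add: w_def)
  \<comment> \<open>The zero term only fits the two-function form of
    \<open>bounded_variation_dominated\<close>.\<close>
  have w_diff: "\<bar>w x - w y\<bar> \<le> M * \<bar>\<phi> x - \<phi> y\<bar> + 0 * \<bar>\<phi> x - \<phi> y\<bar>"
    if "x \<in> {a..b}" "y \<in> {a..b}" for x y
    using exp_diff_le w_le[OF that(1)] w_le[OF that(2)] by (simp add: w_def)
  have w_bv: "bounded_variation a b w"
    by (rule bounded_variation_dominated(1)[OF ab assms(9,9) less_imp_le[OF M] order_refl]) (rule w_diff)
  have "?V w \<le> M * ?V \<phi> + 0 * ?V \<phi>"
    by (rule bounded_variation_dominated(2)[OF ab assms(9,9) less_imp_le[OF M] order_refl]) (rule w_diff)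
  also have "\<dots> \<le> M * 0.0069"
    using assms(10) M by simp
  finally have V_w: "?V w \<le> M * 0.0069" .
  have L_mem: "L f \<in> ?X" and V_L: "?V (L f) \<le> 1/2 * (K * (M * 0.0069) + M * ?V f)"
    if f: "f \<in> ?X" and K: "\<And>x. x \<in> {a..b} \<Longrightarrow> \<bar>f x\<bar> \<le> K" for f K
  proof -
    have 0: "0 \<le> K"
      using K[OF aI] by linarith
    note bv = bounded_variation_mult[OF ab w_bv BV_space_D(1)[OF f] w_abs K]
    show "L f \<in> ?X"
      using transfer_operator_variation(1)[of \<phi> f] bv(1) by (simp add: L_def w_def)
    have "?V (L f) \<le> 1/2 * ?V (\<lambda>x. w x * f x)"
      using transfer_operator_variation(2)[of \<phi> f] bv(1) by (simp add: L_def w_def)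
    also have "\<dots> \<le> 1/2 * (K * ?V w + M * ?V f)"
      using bv(2) by simp
    also have "\<dots> \<le> 1/2 * (K * (M * 0.0069) + M * ?V f)"
      using mult_left_mono[OF V_w 0] by simp
    finally show "?V (L f) \<le> 1/2 * (K * (M * 0.0069) + M * ?V f)" .
  qed
  have L_abs: "\<bar>L f x\<bar> \<le> M * K" if "x \<in> {a..b}" "\<And>x. x \<in> {a..b} \<Longrightarrow> \<bar>f x\<bar> \<le> K" for f x K
    using transfer_operator_abs_le[of \<phi> M f K x] w_le that by (simp add: L_def w_def)
  have abs_le: "\<bar>h x\<bar> \<le> ?V h" if "h \<in> ?X" "h a = 0" "x \<in> {a..b}" for h x
    using abs_le_total_variation[OF BV_space_D(1)[OF that(1)] that(3)] that(2) by simp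
  have e_bv: "bounded_variation a b e \<and> ?V e = 0"
    by (rule total_variation_const[OF ab]) (simp add: e_def)
  have e_X: "e \<in> ?X"
    using e_bv by (auto simp: BV_space_def e_def)
  have L_bounded: "bounded_linear_operator_on ?X ?N L"
    unfolding bounded_linear_operator_on_def
  proof (intro conjI ballI allI)
    show "L ` ?X \<subseteq> ?X"
    proof (rule image_subsetI)
      fix f assume f: "f \<in> ?X"
      show "L f \<in> ?X"
        by (rule L_mem[OF f abs_le_BV_norm[OF ab f]])
    qed
    show "L (f + g) = L f + L g" for f g
      by (auto simp: fun_eq_iff L_def transfer_operator_def Let_def algebra_simps)
    show "L (s *\<^sub>R f) = s *\<^sub>R L f" for f s
      by (auto simp: fun_eq_iff L_def transfer_operator_def Let_def algebra_simps)
    show "\<exists>K. \<forall>f\<in>?X. ?N (L f) \<le> K * ?N f"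
    proof (intro exI ballI)
      fix f assume f: "f \<in> ?X"
      note le = abs_le_BV_norm[OF ab f]
      have "?N (L f) \<le> M * ?N f + ?V (L f)"
        by (rule BV_norm_le[OF ab L_mem[OF f le] L_abs[OF _ le]])
      also have "\<dots> \<le> M * ?N f + 1/2 * (?N f * (M * 0.0069) + M * ?V f)"
        by (rule add_left_mono[OF V_L[OF f le]])
      also have "\<dots> \<le> M * ?N f + 1/2 * (?N f * (M * 0.0069) + M * ?N f)"
        using mult_left_mono[OF total_variation_le_BV_norm[OF ab f], of M] M by simp
      finally show "?N (L f) \<le> (M * (1 + 1/2 * 1.0069)) * ?N f"
        by (simp add: algebra_simps)
    qed
  qed
  \<comment> \<open>If \<open>h a = 0\<close>, the variation also bounds the supremum, so
    \<open>K = ?V h\<close> is allowed; the factor \<open>1.0069 / 2 = 0.50345\<close> is rounded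
    up.\<close>
  have V_L_kernel: "?V (L h) \<le> 0.51 * M * ?V h" if "h \<in> ?X" "h a = 0" for h
  proof -
    have "?V (L h) \<le> 1/2 * (?V h * (M * 0.0069) + M * ?V h)"
      by (rule V_L[OF that(1) abs_le[OF that]])
    also have "\<dots> = 0.50345 * (M * ?V h)"
      by (simp add: algebra_simps)
    also have "\<dots> \<le> 0.51 * (M * ?V h)"
      using M total_variation_nonneg[OF ab BV_space_D(1)[OF that(1)]] by (intro mult_right_mono) auto
    finally show ?thesis by simp
  qed
  have L_a_kernel: "\<bar>L h a\<bar> \<le> M * ?V h" if "h \<in> ?X" "h a = 0" for h
    by (rule L_abs[OF aI abs_le[OF that]])
  \<comment> \<open>Only the variation of the weight remains, as \<open>e\<close> has none;
    \<open>0.0069 / 2\<close> is rounded up.\<close>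
  have V_L_e: "?V (L e) \<le> 0.0035 * M"
  proof -
    have "?V (L e) \<le> 1/2 * (1 * (M * 0.0069) + M * ?V e)"
      by (rule V_L[OF e_X]) (simp add: e_def)
    then show ?thesis using e_bv M by simp
  qed
  have L_e_a: "0.98 * M \<le> L e a"
  proof -
    have "L e a = 1/2 * (w (b1 a) + w (b2 a))"
      using branch_mem[OF aI] aI by (simp add: L_def w_def e_def transfer_operator_eq)
    then show ?thesis
      using w_ge[OF branch_mem(1)[OF aI]] w_ge[OF branch_mem(2)[OF aI]] by simp
  qed
  \<comment> \<open>With \<open>r = 0.01\<close>, after division by \<open>M\<close>,
    \<open>invariant\<close> reads \<open>0.0035 + 0.0051 \<le> 0.01 * 0.97\<close> and
    \<open>gap\<close> reads \<open>0.52 < 0.97\<close>.\<close>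
  interpret dominated_operator ?X ?N L "\<lambda>f. f a" ?V e "0.51 * M" M "0.0035 * M" "0.98 * M" "0.01"
  proof (unfold_locales, goal_cases)
    case 1
    show ?case by (rule banach_on_BV_space[OF ab])
  next
    case 2
    show ?case by (rule L_bounded)
  next
    case (5 f g)
    then show ?case by (intro total_variation_add_le ab BV_space_D(1))
  next
    case (6 f t)
    then show ?case by (intro total_variation_scaleR ab BV_space_D(1))
  next
    case (7 f)
    then show ?case by (rule abs_le_BV_norm[OF ab _ aI])
  next
    case (8 f)
    then show ?case by (rule total_variation_le_BV_norm[OF ab])
  next
    case (9 f)
    then show ?case by (rule BV_norm_le_twice_variation[OF ab])
  next
    case (13 h)
    then show ?case by (rule V_L_kernel)
  next
    case (14 h)
    then show ?case by (rule L_a_kernel)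
  next
    case 15
    show ?case by (rule V_L_e)
  next
    case 16
    show ?case by (rule L_e_a)
  qed (use e_X e_bv ab M in \<open>simp_all add: e_def\<close>)
  show ?thesis
    using spectral_gap by (simp add: L_def)
qed

end
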